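(* Let $d\geq 4$. Suppose that there are constants $0<c\le C<\infty$ (depending only on $d$) such that the critical infinite-volume two-point function satisfies $$c|x-y|^{-(d-2)}\leq \langle \sigma_x\sigma_y\rangle_{\mathbb{Z}^d}\leq C|x-y|^{-(d-2)}\qquad\text{for all } x\neq y\in\mathbb{Z}^d .$$ Then there exist constants $M>1$ and $c_1>0$ (depending only on $d$) such that for every $n\in\mathbb{N}$, for the Ising model on $\Lambda_{Mn}:=[-Mn,Mn]^d\cap\mathbb{Z}^d$ at $\beta=\beta_c$ and $H=0$ with free boundary conditions, we have $$c_1|x-y|^{-(d-2)}\leq \langle \sigma_x\sigma_y\rangle_{\Lambda_{Mn}}^f\leq C|x-y|^{-(d-2)}\qquad\text{for all } x\neq y\in \Lambda_{n}:=[-n,n]^d\cap\mathbb{Z}^d,$$ where the constant $C$ in the upper bound is the one in the assumed upper bound.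
   Context: $|x-y|$ denotes Euclidean distance. For finite $\Lambda\subset\mathbb{Z}^d$, the Ising model on $\Lambda$ at inverse temperature $\beta\ge 0$ with free boundary conditions and external field $H\in\mathbb{R}$ is the probability measure on $\{-1,+1\}^\Lambda$ given by $$\mathbb{P}^f_{\Lambda,\beta,H}(\sigma)=\frac{1}{Z^f_{\Lambda,\beta,H}}\exp\Big[\beta\sum_{\{x,y\}}\sigma_x\sigma_y+H\sum_{x\in\Lambda}\sigma_x\Big],$$ where the first sum is over all nearest-neighbor pairs $\{x,y\}$ in $\Lambda$ and $Z^f_{\Lambda,\beta,H}$ is the normalizing constant. Expectation with respect to this measure is $\langle\cdot\rangle^f_{\Lambda,\beta,H}$. These measures converge as $\Lambda\uparrow\mathbb{Z}^d$ to an infinite-volume measure $\mathbb{P}^f_{\mathbb{Z}^d,\beta,H}$. $\beta_c=\beta_c(\mathbb{Z}^d)$ is the critical inverse temperature of the nearest-neighbor Ising model on $\mathbb{Z}^d$ (the infimum of those $\beta$ for which the infinite-volume plus-boundary-condition state with $H=0$ has $\langle\sigma_0\rangle>0$); for $\beta\le\beta_c$ the infinite-volume limit does not depend on boundary conditions or on the sequence $\Lambda\uparrow\mathbb{Z}^d$. We write $\langle\cdot\rangle^f_\Lambda:=\langle\cdot\rangle^f_{\Lambda,\beta_c,0}$, and $\langle\sigma_x\sigma_y\rangle_{\mathbb{Z}^d}:=\lim_{\Lambda\uparrow\mathbb{Z}^d}\langle\sigma_x\sigma_y\rangle^f_{\Lambda}$ is the critical infinite-volume two-point function. *)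

theory Defs
  imports "HOL-Analysis.Analysis"
begin

text \<open>
  The lattice \<open>\<int>\<^sup>d\<close> is the type \<^typ>\<open>int ^ 'd\<close> with \<open>d = CARD('d)\<close>. Spins are real numbers, so that
  observables are real-valued functions of configurations \<^typ>\<open>int ^ 'd \<Rightarrow> real\<close>.
\<close>

definition euclid :: "int ^ 'd \<Rightarrow> real ^ 'd" where
  "euclid x = (\<chi> i. real_of_int (x $ i))"

definition box_lattice :: "real \<Rightarrow> (int ^ 'd) set" where
  "box_lattice r = {x. \<forall>i. - r \<le> real_of_int (x $ i) \<and> real_of_int (x $ i) \<le> r}"

definition nn_edges :: "(int ^ 'd) set set" where
  "nn_edges = {{x, y} | x y. (\<Sum>i\<in>UNIV. \<bar>x $ i - y $ i\<bar>) = 1}"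

text \<open>
  As edges are two-element sets \<open>e = {x, y}\<close>, the interaction \<open>\<sigma> x * \<sigma> y\<close> is the product of \<open>\<sigma>\<close> over \<open>e\<close>.
\<close>

definition boltzmann_weight ::
    "(int ^ 'd) set set \<Rightarrow> (int ^ 'd) set \<Rightarrow> real \<Rightarrow> real \<Rightarrow> (int ^ 'd \<Rightarrow> real) \<Rightarrow> real" where
  "boltzmann_weight E \<Lambda> \<beta> H \<sigma> = exp (\<beta> * (\<Sum>e\<in>E. \<Prod>x\<in>e. \<sigma> x) + H * (\<Sum>x\<in>\<Lambda>. \<sigma> x))"


definition free_configs :: "(int ^ 'd) set \<Rightarrow> (int ^ 'd \<Rightarrow> real) set" where
  "free_configs \<Lambda> = (\<Pi>\<^sub>E x\<in>\<Lambda>. {-1, 1})"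

definition free_edges :: "(int ^ 'd) set \<Rightarrow> (int ^ 'd) set set" where
  "free_edges \<Lambda> = {e \<in> nn_edges. e \<subseteq> \<Lambda>}"

definition free_partition :: "(int ^ 'd) set \<Rightarrow> real \<Rightarrow> real \<Rightarrow> real" where
  "free_partition \<Lambda> \<beta> H = (\<Sum>\<sigma>\<in>free_configs \<Lambda>. boltzmann_weight (free_edges \<Lambda>) \<Lambda> \<beta> H \<sigma>)"

definition free_prob :: "(int ^ 'd) set \<Rightarrow> real \<Rightarrow> real \<Rightarrow> (int ^ 'd \<Rightarrow> real) \<Rightarrow> real" where
  "free_prob \<Lambda> \<beta> H \<sigma> = boltzmann_weight (free_edges \<Lambda>) \<Lambda> \<beta> H \<sigma> / free_partition \<Lambda> \<beta> H"

definition free_expectation ::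
    "(int ^ 'd) set \<Rightarrow> real \<Rightarrow> real \<Rightarrow> ((int ^ 'd \<Rightarrow> real) \<Rightarrow> real) \<Rightarrow> real" where
  "free_expectation \<Lambda> \<beta> H f = (\<Sum>\<sigma>\<in>free_configs \<Lambda>. f \<sigma> * free_prob \<Lambda> \<beta> H \<sigma>)"


text \<open>
  Plus boundary conditions: configurations are frozen to \<open>+1\<close> off \<open>\<Lambda>\<close>, and the edges that join \<open>\<Lambda>\<close> to its
  complement also contribute to the energy.
\<close>

definition plus_configs :: "(int ^ 'd) set \<Rightarrow> (int ^ 'd \<Rightarrow> real) set" where
  "plus_configs \<Lambda> = {\<sigma>. (\<forall>x\<in>\<Lambda>. \<sigma> x \<in> {-1, 1}) \<and> (\<forall>x. x \<notin> \<Lambda> \<longrightarrow> \<sigma> x = 1)}"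

definition plus_edges :: "(int ^ 'd) set \<Rightarrow> (int ^ 'd) set set" where
  "plus_edges \<Lambda> = {e \<in> nn_edges. e \<inter> \<Lambda> \<noteq> {}}"

definition plus_partition :: "(int ^ 'd) set \<Rightarrow> real \<Rightarrow> real \<Rightarrow> real" where
  "plus_partition \<Lambda> \<beta> H = (\<Sum>\<sigma>\<in>plus_configs \<Lambda>. boltzmann_weight (plus_edges \<Lambda>) \<Lambda> \<beta> H \<sigma>)"

definition plus_prob :: "(int ^ 'd) set \<Rightarrow> real \<Rightarrow> real \<Rightarrow> (int ^ 'd \<Rightarrow> real) \<Rightarrow> real" where
  "plus_prob \<Lambda> \<beta> H \<sigma> = boltzmann_weight (plus_edges \<Lambda>) \<Lambda> \<beta> H \<sigma> / plus_partition \<Lambda> \<beta> H"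

definition plus_expectation ::
    "(int ^ 'd) set \<Rightarrow> real \<Rightarrow> real \<Rightarrow> ((int ^ 'd \<Rightarrow> real) \<Rightarrow> real) \<Rightarrow> real" where
  "plus_expectation \<Lambda> \<beta> H f = (\<Sum>\<sigma>\<in>plus_configs \<Lambda>. f \<sigma> * plus_prob \<Lambda> \<beta> H \<sigma>)"


text \<open>
  The limit \<open>\<Lambda> \<up> \<int>\<^sup>d\<close> is taken along the net of all finite subsets of the lattice. By correlation
  inequalities the plus magnetization decreases in \<open>\<Lambda>\<close> and the free two-point function at \<open>H = 0\<close>
  increases in \<open>\<Lambda>\<close> for \<open>\<beta> \<ge> 0\<close>, so both limits exist.
\<close>

definition plus_magnetization :: "'d::finite itself \<Rightarrow> real \<Rightarrow> real" where
  "plus_magnetization _ \<beta> =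
     Lim (finite_subsets_at_top UNIV) (\<lambda>\<Lambda> :: (int ^ 'd) set. plus_expectation \<Lambda> \<beta> 0 (\<lambda>\<sigma>. \<sigma> 0))"

definition beta_c :: "'d::finite itself \<Rightarrow> real" where
  "beta_c d = Inf {\<beta>. 0 \<le> \<beta> \<and> plus_magnetization d \<beta> > 0}"

definition critical_free_two_point :: "(int ^ 'd) set \<Rightarrow> int ^ 'd \<Rightarrow> int ^ 'd \<Rightarrow> real" where
  "critical_free_two_point \<Lambda> x y = free_expectation \<Lambda> (beta_c TYPE('d)) 0 (\<lambda>\<sigma>. \<sigma> x * \<sigma> y)"

definition critical_two_point :: "int ^ 'd \<Rightarrow> int ^ 'd \<Rightarrow> real" where
  "critical_two_point x y =
     Lim (finite_subsets_at_top UNIV) (\<lambda>\<Lambda>. critical_free_two_point \<Lambda> x y)"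

end

theory Submission
  imports Defs
begin

text \<open>
  The upper bound is Griffiths' second inequality: the free two-point function increases with the
  volume (\<open>free_corr_mono\<close>), so in a box it is at most its infinite-volume limit.

  The lower bound compares a free boundary with a mirror. Let a finite set \<open>V\<close> be symmetric under the
  reflection \<open>\<theta>\<close> in a lattice plane that lies halfway between two layers of sites, and let \<open>H\<close> be the
  part of \<open>V\<close> on one side of it. Then
  \<open>\<langle>\<sigma>\<^sub>x \<sigma>\<^sub>y\<rangle>\<^sub>V - \<langle>\<sigma>\<^sub>x \<sigma>\<^bsub>\<theta> y\<^esub>\<rangle>\<^sub>V \<le> \<langle>\<sigma>\<^sub>x \<sigma>\<^sub>y\<rangle>\<^sub>H\<close>
  (\<open>free_corr_reflection\<close>): the left-hand side is half the correlation of \<open>\<sigma> - \<sigma> \<circ> \<theta>\<close> with itself, and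
  the ferromagnetic bonds that cross the mirror penalise this odd part of the field. In the
  Gaussian analogue the odd part is the field on \<open>H\<close> with an additional mass along the mirror, and the
  inequality is the method of images.

  Start from the box of radius \<open>l = M n\<close>. Reflecting it in one of its faces at a time, through all
  coordinate directions, at least doubles the radius. Each reflection costs one term
  \<open>\<langle>\<sigma>\<^sub>x \<sigma>\<^bsub>\<theta> y\<^esub>\<rangle>\<close>, where \<open>\<theta> y\<close> is at distance at least \<open>l - n\<close> from \<open>x\<close>; by the upper bound the cost is at
  most \<open>C (l - n)\<^bsup>-(d-2)\<^esup>\<close>. Iterating, the costs at the radii \<open>2\<^sup>j l\<close> form a geometric series, so in the
  limit the box of radius \<open>M n\<close> loses at most a constant times \<open>((M - 1) n)\<^bsup>-(d-2)\<^esup>\<close> against the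
  infinite volume (\<open>free_corr_le_box\<close>). As \<open>|x - y|\<close> is at most of order \<open>n\<close>, this is at most half of
  the assumed lower bound when \<open>M\<close> is large.

  Both correlation inequalities come from Ginibre's method of duplicated spins. In suitable linear
  combinations of the copies, the interaction and the observable are polynomials with nonnegative
  coefficients, and every single-site moment is nonnegative; hence so is the whole expectation
  (\<open>cone_exp_sum_nonneg\<close>). Griffiths' inequalities need two copies. The reflection inequality needs four:
  the spins of \<open>V\<close> on the two sides of the mirror, and two independent copies of the model on \<open>H\<close>.

  All this requires \<open>\<beta>\<^sub>c \<ge> 0\<close>. This follows from the assumed strict positivity of the two-point function:
  at a negative \<open>\<beta>\<close> neighbouring spins would be nonpositively correlated.
\<close>

section \<open>Nonnegative combinations of site monomials\<close>

text \<open>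
  The closure of products over the sites of functions from \<open>M\<close> under sums and nonnegative multiples.
  Each member has a nonnegative integral against a product measure as soon as the functions in \<open>M\<close>
  have nonnegative moments at every site.
\<close>

inductive site_cone :: "'v set \<Rightarrow> ('w \<Rightarrow> real) set \<Rightarrow> (('v \<Rightarrow> 'w) \<Rightarrow> real) \<Rightarrow> bool"
  for V :: "'v set" and M :: "('w \<Rightarrow> real) set" where
  monomial: "(\<And>v. v \<in> V \<Longrightarrow> m v \<in> M) \<Longrightarrow> site_cone V M (\<lambda>\<omega>. \<Prod>v\<in>V. m v (\<omega> v))"
| zero: "site_cone V M (\<lambda>_. 0)"
| add: "site_cone V M f \<Longrightarrow> site_cone V M g \<Longrightarrow> site_cone V M (\<lambda>\<omega>. f \<omega> + g \<omega>)"
| scale: "0 \<le> c \<Longrightarrow> site_cone V M f \<Longrightarrow> site_cone V M (\<lambda>\<omega>. c * f \<omega>)"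

locale positive_moments =
  fixes V :: "'v set" and \<Omega> :: "'w set" and w :: "'v \<Rightarrow> 'w \<Rightarrow> real" and M :: "('w \<Rightarrow> real) set"
  assumes finite_V: "finite V" and finite_states: "finite \<Omega>"
    and one_in: "(\<lambda>_. 1) \<in> M"
    and mult_in: "\<And>m m'. m \<in> M \<Longrightarrow> m' \<in> M \<Longrightarrow> (\<lambda>a. m a * m' a) \<in> M"
    and moment_nonneg: "\<And>v m. v \<in> V \<Longrightarrow> m \<in> M \<Longrightarrow> 0 \<le> (\<Sum>a\<in>\<Omega>. w v a * m a)"
begin

abbreviation cone :: "(('v \<Rightarrow> 'w) \<Rightarrow> real) \<Rightarrow> bool" where
  "cone \<equiv> site_cone V M"

lemma cone_mult:
  assumes "cone f" "cone g"
  shows "cone (\<lambda>\<omega>. f \<omega> * g \<omega>)"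
  using assms(1)
proof (induction rule: site_cone.induct)
  case (monomial m)
  from assms(2) show ?case
  proof (induction rule: site_cone.induct)
    case (monomial m')
    have "cone (\<lambda>\<omega>. \<Prod>v\<in>V. (\<lambda>a. m v a * m' v a) (\<omega> v))"
      by (rule site_cone.monomial) (use mult_in monomial \<open>\<And>v. v \<in> V \<Longrightarrow> m v \<in> M\<close> in blast)
    then show ?case by (simp add: prod.distrib)
  next
    case zero
    show ?case using site_cone.zero by simp
  next
    case (add f g)
    then show ?case using site_cone.add[OF add.IH] by (simp add: distrib_left)
  next
    case (scale c f)
    then show ?case using site_cone.scale[OF scale(1) scale.IH] by (simp add: mult.left_commute)
  qed
next
  case zero
  show ?case using site_cone.zero by simp
next
  case (add f g)
  then show ?case using site_cone.add[OF add.IH] by (simp add: distrib_right)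
next
  case (scale c f)
  then show ?case using site_cone.scale[OF scale(1) scale.IH] by (simp add: mult.assoc)
qed

lemma cone_one: "cone (\<lambda>_. 1)"
  using site_cone.monomial[of V "\<lambda>_ _. 1" M] one_in by simp

lemma cone_site:
  assumes "u \<in> V" "m \<in> M"
  shows "cone (\<lambda>\<omega>. m (\<omega> u))"
proof -
  have "cone (\<lambda>\<omega>. \<Prod>v\<in>V. (if v = u then m else (\<lambda>_. 1)) (\<omega> v))"
    by (rule site_cone.monomial) (use assms one_in in auto)
  moreover have "(\<Prod>v\<in>V. (if v = u then m else (\<lambda>_. 1)) (\<omega> v)) = m (\<omega> u)" for \<omega>
  proof -
    have "(\<Prod>v\<in>V. (if v = u then m else (\<lambda>_. 1)) (\<omega> v)) = (\<Prod>v\<in>V. if v = u then m (\<omega> v) else 1)"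
      by (rule prod.cong) auto
    also have "\<dots> = m (\<omega> u)" using finite_V assms(1) by (simp add: prod.delta)
    finally show ?thesis .
  qed
  ultimately show ?thesis by simp
qed

lemma cone_sum:
  assumes "\<And>i. i \<in> I \<Longrightarrow> cone (f i)"
  shows "cone (\<lambda>\<omega>. \<Sum>i\<in>I. f i \<omega>)"
  using assms
  by (induction I rule: infinite_finite_induct) (auto intro: site_cone.intros)

lemma cone_power:
  assumes "cone f"
  shows "cone (\<lambda>\<omega>. f \<omega> ^ n)"
  by (induction n) (auto intro: cone_one cone_mult assms)

lemma cone_sum_nonneg:
  assumes "cone f"
  shows "0 \<le> (\<Sum>\<omega>\<in>V \<rightarrow>\<^sub>E \<Omega>. f \<omega> * (\<Prod>v\<in>V. w v (\<omega> v)))"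
  using assms
proof (induction rule: site_cone.induct)
  case (monomial m)
  have "(\<Sum>\<omega>\<in>V \<rightarrow>\<^sub>E \<Omega>. (\<Prod>v\<in>V. m v (\<omega> v)) * (\<Prod>v\<in>V. w v (\<omega> v)))
      = (\<Sum>\<omega>\<in>V \<rightarrow>\<^sub>E \<Omega>. \<Prod>v\<in>V. w v (\<omega> v) * m v (\<omega> v))"
    by (simp add: prod.distrib mult.commute)
  also have "\<dots> = (\<Prod>v\<in>V. \<Sum>a\<in>\<Omega>. w v a * m v a)"
    by (rule prod_sum_PiE[symmetric]) (auto simp: finite_V finite_states)
  also have "\<dots> \<ge> 0" using monomial moment_nonneg by (intro prod_nonneg) auto
  finally show ?case .
next
  case (scale c f)
  have "(\<Sum>\<omega>\<in>V \<rightarrow>\<^sub>E \<Omega>. c * f \<omega> * (\<Prod>v\<in>V. w v (\<omega> v)))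
      = c * (\<Sum>\<omega>\<in>V \<rightarrow>\<^sub>E \<Omega>. f \<omega> * (\<Prod>v\<in>V. w v (\<omega> v)))"
    by (simp add: sum_distrib_left mult.assoc)
  then show ?case using scale by simp
qed (auto simp: distrib_right sum.distrib)

text \<open>
  A Gibbs factor \<open>exp f\<close> is the limit of the powers \<open>(1 + f / n)\<^sup>n\<close>, which lie in the cone with \<open>f\<close>;
  only finitely many configurations are summed, so pointwise convergence is enough.
\<close>

lemma cone_exp_sum_nonneg:
  assumes "cone g" "cone f"
  shows "0 \<le> (\<Sum>\<omega>\<in>V \<rightarrow>\<^sub>E \<Omega>. g \<omega> * exp (f \<omega>) * (\<Prod>v\<in>V. w v (\<omega> v)))"
proof (rule LIMSEQ_le_const)
  show "(\<lambda>n. \<Sum>\<omega>\<in>V \<rightarrow>\<^sub>E \<Omega>. g \<omega> * (1 + f \<omega> / real n) ^ n * (\<Prod>v\<in>V. w v (\<omega> v)))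
      \<longlonglongrightarrow> (\<Sum>\<omega>\<in>V \<rightarrow>\<^sub>E \<Omega>. g \<omega> * exp (f \<omega>) * (\<Prod>v\<in>V. w v (\<omega> v)))"
    by (intro tendsto_intros tendsto_exp_limit_sequentially)
  have "0 \<le> (\<Sum>\<omega>\<in>V \<rightarrow>\<^sub>E \<Omega>. g \<omega> * (1 + f \<omega> / real n) ^ n * (\<Prod>v\<in>V. w v (\<omega> v)))" for n
  proof (rule cone_sum_nonneg[of "\<lambda>\<omega>. g \<omega> * (1 + f \<omega> / real n) ^ n"])
    \<comment> \<open>At \<open>n = 0\<close> division by zero makes the base equal to 1.\<close>
    have "cone (\<lambda>\<omega>. 1 + (1 / real n) * f \<omega>)"
      by (intro site_cone.add cone_one site_cone.scale assms) simp
    then have "cone (\<lambda>\<omega>. 1 + f \<omega> / real n)" by simp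
    then show "cone (\<lambda>\<omega>. g \<omega> * (1 + f \<omega> / real n) ^ n)"
      by (intro cone_mult cone_power assms)
  qed
  then show "\<exists>N. \<forall>n\<ge>N. 0 \<le> (\<Sum>\<omega>\<in>V \<rightarrow>\<^sub>E \<Omega>. g \<omega> * (1 + f \<omega> / real n) ^ n * (\<Prod>v\<in>V. w v (\<omega> v)))"
    by blast
qed

end

section \<open>Single-site moments of duplicated spins\<close>

definition pair_monomials :: "(real \<times> real \<Rightarrow> real) set" where
  "pair_monomials = {\<lambda>(a, b). (a + b) ^ j * (a - b) ^ k | j k. True}"

text \<open>
  Here \<open>a\<close> and \<open>a'\<close> stand for the spins at a site and at its mirror image, and \<open>b\<close>, \<open>b'\<close> for two
  independent copies. With the even parts \<open>s = a + a'\<close>, \<open>s' = b + b'\<close> and the odd parts \<open>t = a - a'\<close>,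
  \<open>t' = b - b'\<close> these are the monomials in \<open>s + s'\<close>, \<open>s - s'\<close>, \<open>t + t'\<close> and \<open>t' - t\<close>. The last
  difference is oriented the other way because the coupling across the mirror acts on the first pair
  only: it favours \<open>s\<close> over \<open>s'\<close> and \<open>t'\<close> over \<open>t\<close>.
\<close>

definition quad_monomials :: "((real \<times> real) \<times> (real \<times> real) \<Rightarrow> real) set" where
  "quad_monomials = {\<lambda>((a, a'), (b, b')).
     ((a + a') + (b + b')) ^ j * ((a + a') - (b + b')) ^ k *
     ((a - a') + (b - b')) ^ l * ((b - b') - (a - a')) ^ m | j k l m. True}"

lemma pair_moment_nonneg:
  assumes "f \<in> pair_monomials"
  shows "0 \<le> (\<Sum>p\<in>{-1, 1} \<times> {-1, 1}. f p)"
proof -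
  obtain j k where f: "f = (\<lambda>(a, b). (a + b) ^ j * (a - b) ^ k)"
    using assms unfolding pair_monomials_def by blast
  show ?thesis unfolding f
    by (simp add: sum.cartesian_product[symmetric] uminus_power_if power_0_left)
qed

text \<open>
  Of \<open>s\<close> and \<open>t\<close> exactly one vanishes, and likewise for \<open>s'\<close> and \<open>t'\<close>. If both pairs have the same type,
  the moment is one of two ordinary spins. In the mixed states the sum over signs vanishes unless
  \<open>j + k\<close> and \<open>l + m\<close> are even; then the states with \<open>s, t' \<noteq> 0\<close> contribute a positive multiple of \<open>exp h\<close>
  and those with \<open>t, s' \<noteq> 0\<close> the same multiple of \<open>\<plusminus> exp (- h)\<close>, so the total is nonnegative for \<open>h \<ge> 0\<close>.
\<close>

lemma quad_moment_nonneg: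
  assumes "f \<in> quad_monomials" "0 \<le> h"
  shows "0 \<le> (\<Sum>p\<in>({-1, 1} \<times> {-1, 1}) \<times> ({-1, 1} \<times> {-1, 1}).
           exp (h * (fst (fst p) * snd (fst p))) * f p)"
proof -
  obtain j k l m where f: "f = (\<lambda>((a, a'), (b, b')).
     ((a + a') + (b + b')) ^ j * ((a + a') - (b + b')) ^ k *
     ((a - a') + (b - b')) ^ l * ((b - b') - (a - a')) ^ m)"
    using assms unfolding quad_monomials_def by blast
  have h: "exp (-h) \<le> exp h" using assms(2) by simp
  define X :: real where "X = 2 ^ j * 2 ^ k * 2 ^ l * 2 ^ m"
  have X: "0 \<le> X" by (simp add: X_def)
  have hX: "exp (-h) * X \<le> exp h * X" using h X by (intro mult_right_mono)
  show ?thesis unfolding f using hX unfolding X_def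
    by (auto simp: sum.cartesian_product[symmetric] uminus_power_if power_0_left mult_ac)
qed

section \<open>Ising sums on finite graphs\<close>

definition edges_in :: "'v set set \<Rightarrow> 'v set \<Rightarrow> bool" where
  "edges_in E V \<longleftrightarrow> finite E \<and> (\<forall>e\<in>E. \<exists>u\<in>V. \<exists>v\<in>V. u \<noteq> v \<and> e = {u, v})"

definition energy :: "'v set set \<Rightarrow> ('v \<Rightarrow> real) \<Rightarrow> real" where
  "energy E \<sigma> = (\<Sum>e\<in>E. \<Prod>x\<in>e. \<sigma> x)"

definition spin_sum :: "'v set \<Rightarrow> 'v set set \<Rightarrow> real \<Rightarrow> (('v \<Rightarrow> real) \<Rightarrow> real) \<Rightarrow> real" where
  "spin_sum V E \<beta> f = (\<Sum>\<sigma>\<in>V \<rightarrow>\<^sub>E {-1, 1}. f \<sigma> * exp (\<beta> * energy E \<sigma>))"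

definition corr :: "'v set \<Rightarrow> 'v set set \<Rightarrow> real \<Rightarrow> 'v \<Rightarrow> 'v \<Rightarrow> real" where
  "corr V E \<beta> x y = spin_sum V E \<beta> (\<lambda>\<sigma>. \<sigma> x * \<sigma> y) / spin_sum V E \<beta> (\<lambda>_. 1)"

lemma edges_inE:
  assumes "edges_in E V" "e \<in> E"
  obtains u v where "u \<in> V" "v \<in> V" "u \<noteq> v" "e = {u, v}"
  using assms unfolding edges_in_def by metis

lemma edges_in_subset: "edges_in E V \<Longrightarrow> e \<in> E \<Longrightarrow> e \<subseteq> V"
  by (erule (1) edges_inE) simp

lemma edges_in_mono: "edges_in E' V \<Longrightarrow> E \<subseteq> E' \<Longrightarrow> edges_in E V"
  unfolding edges_in_def by (meson finite_subset subset_iff)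

lemma energy_cong:
  assumes "edges_in E V" "\<And>v. v \<in> V \<Longrightarrow> \<sigma> v = \<tau> v"
  shows "energy E \<sigma> = energy E \<tau>"
  unfolding energy_def
proof (intro sum.cong prod.cong refl)
  fix e v assume "e \<in> E" "v \<in> e"
  then show "\<sigma> v = \<tau> v" using edges_in_subset[OF assms(1)] assms(2) by blast
qed

lemma energy_restrict:
  assumes "edges_in E V"
  shows "energy E (restrict \<sigma> V) = energy E \<sigma>"
  by (rule energy_cong[OF assms]) simp

lemma spin_sum_one_pos:
  assumes "finite V"
  shows "0 < spin_sum V E \<beta> (\<lambda>_. 1)"
  unfolding spin_sum_def using assms
  by (intro sum_pos finite_PiE) (auto simp: PiE_eq_empty_iff)

lemma spin_sum_product:
  "(\<Sum>\<sigma>\<in>V \<rightarrow>\<^sub>E {-1, 1}. \<Sum>\<tau>\<in>V \<rightarrow>\<^sub>E {-1, 1}.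
      f \<sigma> * g \<tau> * exp (\<beta> * (energy E \<sigma> + energy E' \<tau>)))
    = spin_sum V E \<beta> f * spin_sum V E' \<beta> g"
  unfolding spin_sum_def sum_product
  by (intro sum.cong refl) (simp add: distrib_left exp_add mult_ac)

lemma sum_PiE_Times:
  "(\<Sum>\<omega>\<in>V \<rightarrow>\<^sub>E A \<times> B. F (\<lambda>v\<in>V. fst (\<omega> v)) (\<lambda>v\<in>V. snd (\<omega> v)))
    = (\<Sum>\<sigma>\<in>V \<rightarrow>\<^sub>E A. \<Sum>\<tau>\<in>V \<rightarrow>\<^sub>E B. F \<sigma> \<tau>)"
  unfolding sum.cartesian_product
  by (rule sum.reindex_bij_witness[where
        i = "\<lambda>(\<sigma>, \<tau>). \<lambda>v\<in>V. (\<sigma> v, \<tau> v)" and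
        j = "\<lambda>\<omega>. (\<lambda>v\<in>V. fst (\<omega> v), \<lambda>v\<in>V. snd (\<omega> v))"])
     (auto simp: PiE_def Pi_def extensional_def fun_eq_iff mem_Times_iff)

section \<open>Griffiths inequalities\<close>

lemma positive_moments_pair:
  assumes "finite V"
  shows "positive_moments V ({-1, 1} \<times> {-1, 1}) (\<lambda>_ _. 1) pair_monomials"
proof
  show "(\<lambda>_. 1) \<in> pair_monomials"
    unfolding pair_monomials_def by (intro CollectI exI[of _ 0]) auto
  show "(\<lambda>a. m a * m' a) \<in> pair_monomials"
    if m: "m \<in> pair_monomials" "m' \<in> pair_monomials" for m m'
  proof -
    obtain j k j' k' where "m = (\<lambda>(a, b). (a + b) ^ j * (a - b) ^ k)"
      and "m' = (\<lambda>(a, b). (a + b) ^ j' * (a - b) ^ k')"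
      using m unfolding pair_monomials_def by blast
    then have "(\<lambda>a. m a * m' a) = (\<lambda>(a, b). (a + b) ^ (j + j') * (a - b) ^ (k + k'))"
      by (auto simp: fun_eq_iff power_add)
    then show ?thesis unfolding pair_monomials_def by blast
  qed
qed (use assms pair_moment_nonneg in auto)

lemma pair_cone_sum:
  assumes "u \<in> V" "finite V"
  shows "site_cone V pair_monomials (\<lambda>\<omega>. fst (\<omega> u) + snd (\<omega> u))"
proof -
  interpret positive_moments V "{-1, 1} \<times> {-1, 1}" "\<lambda>_ _. 1" pair_monomials
    by (rule positive_moments_pair) fact
  have "(\<lambda>(a, b). (a + b) ^ 1 * (a - b) ^ 0) \<in> pair_monomials"
    unfolding pair_monomials_def by blast
  from cone_site[OF assms(1) this] show ?thesis by (simp add: case_prod_beta)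
qed

lemma pair_cone_diff:
  assumes "u \<in> V" "finite V"
  shows "site_cone V pair_monomials (\<lambda>\<omega>. fst (\<omega> u) - snd (\<omega> u))"
proof -
  interpret positive_moments V "{-1, 1} \<times> {-1, 1}" "\<lambda>_ _. 1" pair_monomials
    by (rule positive_moments_pair) fact
  have "(\<lambda>(a, b). (a + b) ^ 0 * (a - b) ^ 1) \<in> pair_monomials"
    unfolding pair_monomials_def by blast
  from cone_site[OF assms(1) this] show ?thesis by (simp add: case_prod_beta)
qed

lemma pair_cone_fst:
  assumes "u \<in> V" "finite V"
  shows "site_cone V pair_monomials (\<lambda>\<omega>. fst (\<omega> u))"
proof -
  have "site_cone V pair_monomials
      (\<lambda>\<omega>. 1 / 2 * ((fst (\<omega> u) + snd (\<omega> u)) + (fst (\<omega> u) - snd (\<omega> u))))"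
    by (intro site_cone.scale site_cone.add pair_cone_sum pair_cone_diff assms) simp
  then show ?thesis by simp
qed

text \<open>
  For bonds common to both graphs the interaction is
  \<open>\<sigma>\<^sub>u \<sigma>\<^sub>v + \<tau>\<^sub>u \<tau>\<^sub>v = ((\<sigma> + \<tau>)\<^sub>u (\<sigma> + \<tau>)\<^sub>v + (\<sigma> - \<tau>)\<^sub>u (\<sigma> - \<tau>)\<^sub>v) / 2\<close>, and a bond of the larger
  graph alone couples the copy \<open>\<sigma> = ((\<sigma> + \<tau>) + (\<sigma> - \<tau>)) / 2\<close>. Hence the first copy has to live on the
  larger graph.
\<close>

lemma ginibre_two_copies:
  assumes V: "finite V" and E': "edges_in E' V" and sub: "E \<subseteq> E'" and \<beta>: "0 \<le> \<beta>"
    and G: "site_cone V pair_monomials (\<lambda>\<omega>. G (\<lambda>v\<in>V. fst (\<omega> v)) (\<lambda>v\<in>V. snd (\<omega> v)))"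
  shows "0 \<le> (\<Sum>\<sigma>\<in>V \<rightarrow>\<^sub>E {-1, 1}. \<Sum>\<tau>\<in>V \<rightarrow>\<^sub>E {-1, 1}.
                G \<sigma> \<tau> * exp (\<beta> * (energy E' \<sigma> + energy E \<tau>)))"
proof -
  interpret positive_moments V "{-1, 1} \<times> {-1, 1}" "\<lambda>_ _. 1" pair_monomials
    by (rule positive_moments_pair) fact
  have E: "edges_in E V" using edges_in_mono[OF E' sub] .
  have fin: "finite E'" using E' by (simp add: edges_in_def)
  have both: "cone (\<lambda>\<omega>. (\<Prod>v\<in>e. fst (\<omega> v)) + (\<Prod>v\<in>e. snd (\<omega> v)))" if e: "e \<in> E" for e
  proof -
    obtain u v where uv: "u \<in> V" "v \<in> V" "u \<noteq> v" "e = {u, v}"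
      using edges_inE[OF E e] .
    have "cone (\<lambda>\<omega>. 1 / 2 * ((fst (\<omega> u) + snd (\<omega> u)) * (fst (\<omega> v) + snd (\<omega> v))
                          + (fst (\<omega> u) - snd (\<omega> u)) * (fst (\<omega> v) - snd (\<omega> v))))"
      by (intro site_cone.scale site_cone.add cone_mult pair_cone_sum pair_cone_diff uv V) simp
    then show ?thesis using uv by (simp add: algebra_simps)
  qed
  have first: "cone (\<lambda>\<omega>. \<Prod>v\<in>e. fst (\<omega> v))" if e: "e \<in> E'" for e
  proof -
    obtain u v where uv: "u \<in> V" "v \<in> V" "u \<noteq> v" "e = {u, v}"
      using edges_inE[OF E' e] .
    have "cone (\<lambda>\<omega>. fst (\<omega> u) * fst (\<omega> v))"
      by (intro cone_mult pair_cone_fst uv V)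
    then show ?thesis using uv by simp
  qed
  \<comment> \<open>The exponent, with the bonds common to both graphs collected.\<close>
  let ?f = "\<lambda>\<omega>. \<beta> * ((\<Sum>e\<in>E' - E. \<Prod>v\<in>e. fst (\<omega> v))
                     + (\<Sum>e\<in>E. (\<Prod>v\<in>e. fst (\<omega> v)) + (\<Prod>v\<in>e. snd (\<omega> v))))"
  have "cone ?f"
    by (intro site_cone.scale site_cone.add cone_sum first both \<beta>) auto
  from cone_exp_sum_nonneg[OF G this]
  have *: "0 \<le> (\<Sum>\<omega>\<in>V \<rightarrow>\<^sub>E {-1, 1} \<times> {-1, 1}.
            G (\<lambda>v\<in>V. fst (\<omega> v)) (\<lambda>v\<in>V. snd (\<omega> v)) * exp (?f \<omega>))"
    by simp
  have f: "?f \<omega> = \<beta> * (energy E' (\<lambda>v\<in>V. fst (\<omega> v)) + energy E (\<lambda>v\<in>V. snd (\<omega> v)))" for \<omega>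
    unfolding energy_restrict[OF E] energy_restrict[OF E']
    unfolding energy_def sum.subset_diff[OF sub fin] by (simp add: sum.distrib)
  show ?thesis using * unfolding f sum_PiE_Times
    by (subst sum_PiE_Times[symmetric]) simp
qed

text \<open>
  An observable of the first copy alone: the second copy contributes the factor \<open>Z > 0\<close>.
\<close>

lemma griffiths_first:
  assumes V: "finite V" and E: "edges_in E V" and \<beta>: "0 \<le> \<beta>" and xy: "x \<in> V" "y \<in> V"
  shows "0 \<le> spin_sum V E \<beta> (\<lambda>\<sigma>. \<sigma> x)" and "0 \<le> spin_sum V E \<beta> (\<lambda>\<sigma>. \<sigma> x * \<sigma> y)"
proof -
  interpret positive_moments V "{-1, 1} \<times> {-1, 1}" "\<lambda>_ _. 1" pair_monomials
    by (rule positive_moments_pair) fact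
  note Z = spin_sum_one_pos[OF V, of E \<beta>]
  have "cone (\<lambda>\<omega>. (\<lambda>v\<in>V. fst (\<omega> v)) x * 1)"
    using pair_cone_fst[OF xy(1) V] xy by simp
  from ginibre_two_copies[OF V E subset_refl \<beta>, where G = "\<lambda>\<sigma> \<tau>. \<sigma> x * 1", OF this]
  have "0 \<le> spin_sum V E \<beta> (\<lambda>\<sigma>. \<sigma> x) * spin_sum V E \<beta> (\<lambda>_. 1)"
    by (subst spin_sum_product[symmetric]) simp
  then show "0 \<le> spin_sum V E \<beta> (\<lambda>\<sigma>. \<sigma> x)" using Z by (simp add: zero_le_mult_iff)
  have "cone (\<lambda>\<omega>. (\<lambda>v\<in>V. fst (\<omega> v)) x * (\<lambda>v\<in>V. fst (\<omega> v)) y * 1)"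
    using cone_mult[OF pair_cone_fst[OF xy(1) V] pair_cone_fst[OF xy(2) V]] xy by simp
  from ginibre_two_copies[OF V E subset_refl \<beta>, where G = "\<lambda>\<sigma> \<tau>. \<sigma> x * \<sigma> y * 1", OF this]
  have "0 \<le> spin_sum V E \<beta> (\<lambda>\<sigma>. \<sigma> x * \<sigma> y) * spin_sum V E \<beta> (\<lambda>_. 1)"
    by (subst spin_sum_product[symmetric]) simp
  then show "0 \<le> spin_sum V E \<beta> (\<lambda>\<sigma>. \<sigma> x * \<sigma> y)" using Z by (simp add: zero_le_mult_iff)
qed

text \<open>
  The numerator of the difference of the two correlations is the duplicated sum of
  \<open>\<sigma>\<^sub>x \<sigma>\<^sub>y - \<tau>\<^sub>x \<tau>\<^sub>y = ((\<sigma> + \<tau>)\<^sub>x (\<sigma> - \<tau>)\<^sub>y + (\<sigma> - \<tau>)\<^sub>x (\<sigma> + \<tau>)\<^sub>y) / 2\<close>.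
\<close>

lemma griffiths_second:
  assumes V: "finite V" and E': "edges_in E' V" and sub: "E \<subseteq> E'" and \<beta>: "0 \<le> \<beta>"
    and xy: "x \<in> V" "y \<in> V"
  shows "corr V E \<beta> x y \<le> corr V E' \<beta> x y"
proof -
  interpret positive_moments V "{-1, 1} \<times> {-1, 1}" "\<lambda>_ _. 1" pair_monomials
    by (rule positive_moments_pair) fact
  let ?a = "spin_sum V E' \<beta> (\<lambda>\<sigma>. \<sigma> x * \<sigma> y)" and ?b = "spin_sum V E \<beta> (\<lambda>\<sigma>. \<sigma> x * \<sigma> y)"
  let ?Z' = "spin_sum V E' \<beta> (\<lambda>_. 1)" and ?Z = "spin_sum V E \<beta> (\<lambda>_. 1)"
  let ?G = "\<lambda>\<sigma> \<tau>. \<sigma> x * \<sigma> y * 1 - 1 * (\<tau> x * \<tau> y)"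
  have "cone (\<lambda>\<omega>. 1 / 2 * ((fst (\<omega> x) + snd (\<omega> x)) * (fst (\<omega> y) - snd (\<omega> y))
                        + (fst (\<omega> x) - snd (\<omega> x)) * (fst (\<omega> y) + snd (\<omega> y))))"
    by (intro site_cone.scale site_cone.add cone_mult pair_cone_sum pair_cone_diff xy V) simp
  then have "cone (\<lambda>\<omega>. ?G (\<lambda>v\<in>V. fst (\<omega> v)) (\<lambda>v\<in>V. snd (\<omega> v)))"
    using xy by (simp add: algebra_simps)
  from ginibre_two_copies[OF V E' sub \<beta>, where G = ?G, OF this]
  have "0 \<le> ?a * ?Z - ?Z' * ?b"
    unfolding left_diff_distrib sum_subtractf spin_sum_product by simp
  then show ?thesis unfolding corr_def
    using spin_sum_one_pos[OF V, of E \<beta>] spin_sum_one_pos[OF V, of E' \<beta>]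
    by (simp add: field_simps)
qed

lemma sum_PiE_restrict:
  assumes "V \<inter> W = {}"
  shows "(\<Sum>\<sigma>\<in>V \<union> W \<rightarrow>\<^sub>E S. F (restrict \<sigma> V)) = real (card (W \<rightarrow>\<^sub>E S)) * (\<Sum>\<sigma>\<in>V \<rightarrow>\<^sub>E S. F \<sigma>)"
proof -
  have "(\<Sum>\<sigma>\<in>V \<union> W \<rightarrow>\<^sub>E S. F (restrict \<sigma> V)) = (\<Sum>(\<sigma>, \<tau>)\<in>(V \<rightarrow>\<^sub>E S) \<times> (W \<rightarrow>\<^sub>E S). F \<sigma>)"
    by (rule sum.reindex_bij_witness[where
          i = "\<lambda>(\<sigma>, \<tau>) v. if v \<in> V then \<sigma> v else \<tau> v" and
          j = "\<lambda>\<sigma>. (restrict \<sigma> V, restrict \<sigma> W)"])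
       (use assms in \<open>auto simp: PiE_def Pi_def extensional_def fun_eq_iff\<close>)
  then show ?thesis by (simp add: sum.cartesian_product[symmetric] sum_distrib_left)
qed

text \<open>
  Sites without bonds contribute the same factor to the numerator and to the partition function.
\<close>

lemma corr_add_isolated:
  assumes V: "finite V" and W: "finite W" and sub: "V \<subseteq> W" and E: "edges_in E V"
    and xy: "x \<in> V" "y \<in> V"
  shows "corr W E \<beta> x y = corr V E \<beta> x y"
proof -
  let ?S = "{-1, 1::real}"
  let ?k = "real (card ((W - V) \<rightarrow>\<^sub>E ?S))"
  have k: "?k > 0" using W by (simp add: card_PiE card_gt_0_iff finite_PiE PiE_eq_empty_iff)
  have WV: "W = V \<union> (W - V)" using sub by blast
  have step: "spin_sum W E \<beta> f = ?k * spin_sum V E \<beta> f"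
    if "\<And>\<sigma>. f (restrict \<sigma> V) = f \<sigma>" for f
  proof -
    have "spin_sum W E \<beta> f = (\<Sum>\<sigma>\<in>W \<rightarrow>\<^sub>E ?S. f (restrict \<sigma> V) * exp (\<beta> * energy E (restrict \<sigma> V)))"
      unfolding spin_sum_def energy_restrict[OF E] that ..
    also have "\<dots> = ?k * spin_sum V E \<beta> f"
      unfolding spin_sum_def
      by (subst WV, rule sum_PiE_restrict[of V "W - V" "\<lambda>\<sigma>. f \<sigma> * exp (\<beta> * energy E \<sigma>)"]) blast
    finally show ?thesis .
  qed
  show ?thesis unfolding corr_def using k xy by (simp add: step)
qed

lemma corr_mono:
  assumes "finite W" "V \<subseteq> W" "edges_in E V" "edges_in E' W" "E \<subseteq> E'" "0 \<le> \<beta>" "x \<in> V" "y \<in> V"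
  shows "corr V E \<beta> x y \<le> corr W E' \<beta> x y"
proof -
  have "corr V E \<beta> x y = corr W E \<beta> x y"
    using assms finite_subset by (intro corr_add_isolated[symmetric]) auto
  also have "\<dots> \<le> corr W E' \<beta> x y"
    using assms by (intro griffiths_second) auto
  finally show ?thesis .
qed

section \<open>The reflection inequality\<close>

lemma quad_monomialsI:
  "(\<lambda>((a, a'), (b, b')).
     ((a + a') + (b + b')) ^ j * ((a + a') - (b + b')) ^ k *
     ((a - a') + (b - b')) ^ l * ((b - b') - (a - a')) ^ m) \<in> quad_monomials"
  unfolding quad_monomials_def by blast

lemma positive_moments_quad:
  assumes "finite V" "\<And>v. v \<in> V \<Longrightarrow> 0 \<le> h v"
  shows "positive_moments V (({-1, 1} \<times> {-1, 1}) \<times> ({-1, 1} \<times> {-1, 1}))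
    (\<lambda>v p. exp (h v * (fst (fst p) * snd (fst p)))) quad_monomials"
proof
  show "(\<lambda>_. 1) \<in> quad_monomials"
    using quad_monomialsI[of 0 0 0 0] by (simp add: case_prod_unfold)
  show "(\<lambda>a. f a * f' a) \<in> quad_monomials"
    if f: "f \<in> quad_monomials" "f' \<in> quad_monomials" for f f'
  proof -
    obtain j k l m where 1: "f = (\<lambda>((a, a'), (b, b')).
        ((a + a') + (b + b')) ^ j * ((a + a') - (b + b')) ^ k *
        ((a - a') + (b - b')) ^ l * ((b - b') - (a - a')) ^ m)"
      using f(1) unfolding quad_monomials_def by blast
    obtain j' k' l' m' where 2: "f' = (\<lambda>((a, a'), (b, b')).
        ((a + a') + (b + b')) ^ j' * ((a + a') - (b + b')) ^ k' *
        ((a - a') + (b - b')) ^ l' * ((b - b') - (a - a')) ^ m')"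
      using f(2) unfolding quad_monomials_def by blast
    have "(\<lambda>a. f a * f' a) = (\<lambda>((a, a'), (b, b')).
        ((a + a') + (b + b')) ^ (j + j') * ((a + a') - (b + b')) ^ (k + k') *
        ((a - a') + (b - b')) ^ (l + l') * ((b - b') - (a - a')) ^ (m + m'))"
      unfolding 1 2 by (simp add: fun_eq_iff power_add)
    then show ?thesis using quad_monomialsI by simp
  qed
qed (use assms quad_moment_nonneg in auto)

text \<open>
  A configuration \<open>p\<close> of spin pairs on \<open>H\<close> encodes the spins on both sides of the mirror, with coupling
  across it at the sites of \<open>B\<close>; \<open>q\<close> encodes two independent copies of the model on \<open>H\<close>. A bond adds over
  the four copies to \<open>(s s + t t + s' s' + t' t') / 2\<close>, which is a nonnegative quadratic form in
  \<open>s \<plusminus> s'\<close>, \<open>t + t'\<close>, \<open>t' - t\<close>, and \<open>t'\<^sub>x t'\<^sub>y - t\<^sub>x t\<^sub>y\<close> is one in \<open>t + t'\<close>, \<open>t' - t\<close>. The coupling across the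
  mirror involves single sites only, so it goes into the site weights.
\<close>

lemma reflection_four_copies:
  fixes H :: "'v set"
  assumes H: "finite H" and E: "edges_in E H" and B: "B \<subseteq> H" and \<beta>: "0 \<le> \<beta>"
    and xy: "x \<in> H" "y \<in> H"
  defines "t \<equiv> \<lambda>p u. fst (p u) - snd (p u)"
  defines "W \<equiv> \<lambda>p. exp (\<beta> * (energy E (\<lambda>u. fst (p u)) + energy E (\<lambda>u. snd (p u))))"
  shows "0 \<le> (\<Sum>p\<in>H \<rightarrow>\<^sub>E {-1, 1} \<times> {-1, 1}. \<Sum>q\<in>H \<rightarrow>\<^sub>E {-1, 1} \<times> {-1, 1}.
           (t q x * t q y - t p x * t p y) *
           (W p * exp (\<beta> * (\<Sum>u\<in>B. fst (p u) * snd (p u))) * W q))"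
proof -
  let ?h = "\<lambda>v. if v \<in> B then \<beta> else 0"
  interpret positive_moments H "({-1, 1} \<times> {-1, 1}) \<times> ({-1, 1} \<times> {-1, 1})"
    "\<lambda>v p. exp (?h v * (fst (fst p) * snd (fst p)))" quad_monomials
    by (rule positive_moments_quad) (use H \<beta> in auto)
  define S T S' T' :: "('v \<Rightarrow> (real \<times> real) \<times> (real \<times> real)) \<Rightarrow> 'v \<Rightarrow> real"
    where "S = (\<lambda>\<omega> u. fst (fst (\<omega> u)) + snd (fst (\<omega> u)))"
      and "T = (\<lambda>\<omega> u. fst (fst (\<omega> u)) - snd (fst (\<omega> u)))"
      and "S' = (\<lambda>\<omega> u. fst (snd (\<omega> u)) + snd (snd (\<omega> u)))"
      and "T' = (\<lambda>\<omega> u. fst (snd (\<omega> u)) - snd (snd (\<omega> u)))"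
  note defs = S_def T_def S'_def T'_def
  have gen: "cone (\<lambda>\<omega>. S \<omega> u + S' \<omega> u)" "cone (\<lambda>\<omega>. S \<omega> u - S' \<omega> u)"
       "cone (\<lambda>\<omega>. T \<omega> u + T' \<omega> u)" "cone (\<lambda>\<omega>. T' \<omega> u - T \<omega> u)" if u: "u \<in> H" for u
    using cone_site[OF u quad_monomialsI[of 1 0 0 0]] cone_site[OF u quad_monomialsI[of 0 1 0 0]]
      cone_site[OF u quad_monomialsI[of 0 0 1 0]] cone_site[OF u quad_monomialsI[of 0 0 0 1]]
    unfolding defs by (simp_all add: case_prod_beta)
  let ?e = "\<lambda>\<omega> e. (\<Prod>v\<in>e. fst (fst (\<omega> v))) + (\<Prod>v\<in>e. snd (fst (\<omega> v)))
                + (\<Prod>v\<in>e. fst (snd (\<omega> v))) + (\<Prod>v\<in>e. snd (snd (\<omega> v)))"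
  have edge: "cone (\<lambda>\<omega>. ?e \<omega> e)" if e: "e \<in> E" for e
  proof -
    obtain u v where uv: "u \<in> H" "v \<in> H" "u \<noteq> v" "e = {u, v}"
      using edges_inE[OF E e] .
    have "cone (\<lambda>\<omega>. 1 / 4 *
        ((S \<omega> u + S' \<omega> u) * (S \<omega> v + S' \<omega> v) + (S \<omega> u - S' \<omega> u) * (S \<omega> v - S' \<omega> v)
       + (T \<omega> u + T' \<omega> u) * (T \<omega> v + T' \<omega> v) + (T' \<omega> u - T \<omega> u) * (T' \<omega> v - T \<omega> v)))"
      by (intro site_cone.scale site_cone.add cone_mult gen uv) simp
    then show ?thesis using uv unfolding defs by (simp add: algebra_simps)
  qed
  have f: "cone (\<lambda>\<omega>. \<beta> * (\<Sum>e\<in>E. ?e \<omega> e))"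
    by (intro site_cone.scale cone_sum edge \<beta>)
  have "cone (\<lambda>\<omega>. 1 / 2 *
     ((T \<omega> x + T' \<omega> x) * (T' \<omega> y - T \<omega> y) + (T' \<omega> x - T \<omega> x) * (T \<omega> y + T' \<omega> y)))"
    by (intro site_cone.scale site_cone.add cone_mult gen xy) simp
  then have g: "cone (\<lambda>\<omega>. T' \<omega> x * T' \<omega> y - T \<omega> x * T \<omega> y)"
    by (simp add: algebra_simps)
  let ?r1 = "\<lambda>\<omega>. \<lambda>u\<in>H. fst (\<omega> u)" and ?r2 = "\<lambda>\<omega>. \<lambda>u\<in>H. snd (\<omega> u)"
  let ?F = "\<lambda>p q. (t q x * t q y - t p x * t p y) *
           (W p * exp (\<beta> * (\<Sum>u\<in>B. fst (p u) * snd (p u))) * W q)"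
  have weight: "(\<Prod>v\<in>H. exp (?h v * (fst (fst (\<omega> v)) * snd (fst (\<omega> v)))))
      = exp (\<beta> * (\<Sum>u\<in>B. fst (?r1 \<omega> u) * snd (?r1 \<omega> u)))" for \<omega> :: "'v \<Rightarrow> (real \<times> real) \<times> (real \<times> real)"
  proof -
    have "(\<Sum>v\<in>H. ?h v * (fst (fst (\<omega> v)) * snd (fst (\<omega> v))))
        = (\<Sum>v\<in>B. \<beta> * (fst (fst (\<omega> v)) * snd (fst (\<omega> v))))"
      by (rule sum.mono_neutral_cong_right) (use H B in auto)
    also have "\<dots> = \<beta> * (\<Sum>u\<in>B. fst (?r1 \<omega> u) * snd (?r1 \<omega> u))"
      unfolding sum_distrib_left using B by (intro sum.cong) auto
    finally show ?thesis using H by (simp add: exp_sum[symmetric])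
  qed
  have energies: "exp (\<beta> * (\<Sum>e\<in>E. ?e \<omega> e)) = W (?r1 \<omega>) * W (?r2 \<omega>)" for \<omega>
  proof -
    have "energy E (\<lambda>u. fst (?r1 \<omega> u)) = energy E (\<lambda>u. fst (fst (\<omega> u)))"
      "energy E (\<lambda>u. snd (?r1 \<omega> u)) = energy E (\<lambda>u. snd (fst (\<omega> u)))"
      "energy E (\<lambda>u. fst (?r2 \<omega> u)) = energy E (\<lambda>u. fst (snd (\<omega> u)))"
      "energy E (\<lambda>u. snd (?r2 \<omega> u)) = energy E (\<lambda>u. snd (snd (\<omega> u)))"
      by (rule energy_cong[OF E], simp)+
    then show ?thesis
      unfolding W_def by (simp add: energy_def sum.distrib exp_add distrib_left)
  qed
  have "0 \<le> (\<Sum>\<omega>\<in>H \<rightarrow>\<^sub>E ({-1, 1} \<times> {-1, 1}) \<times> ({-1, 1} \<times> {-1, 1}). ?F (?r1 \<omega>) (?r2 \<omega>))"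
  proof (rule order.trans[OF cone_exp_sum_nonneg[OF g f]], rule eq_refl, rule sum.cong[OF refl])
    fix \<omega> :: "'v \<Rightarrow> (real \<times> real) \<times> (real \<times> real)"
    have "T \<omega> x = t (?r1 \<omega>) x" "T \<omega> y = t (?r1 \<omega>) y" "T' \<omega> x = t (?r2 \<omega>) x" "T' \<omega> y = t (?r2 \<omega>) y"
      using xy unfolding defs t_def by auto
    then show "(T' \<omega> x * T' \<omega> y - T \<omega> x * T \<omega> y) * exp (\<beta> * (\<Sum>e\<in>E. ?e \<omega> e)) *
       (\<Prod>v\<in>H. exp (?h v * (fst (fst (\<omega> v)) * snd (fst (\<omega> v))))) = ?F (?r1 \<omega>) (?r2 \<omega>)"
      unfolding weight energies by (simp add: mult_ac)
  qed
  then show ?thesis unfolding sum_PiE_Times[where F = ?F] .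
qed

lemma sum_PiE_fold:
  assumes inj: "inj_on \<theta> H" and disj: "\<theta> ` H \<inter> H = {}"
  shows "(\<Sum>\<sigma>\<in>H \<union> \<theta> ` H \<rightarrow>\<^sub>E S. G (\<lambda>u\<in>H. (\<sigma> u, \<sigma> (\<theta> u)))) = (\<Sum>p\<in>H \<rightarrow>\<^sub>E S \<times> S. G p)"
proof -
  let ?i = "\<lambda>p v. if v \<in> H then fst (p v)
      else if v \<in> \<theta> ` H then snd (p (inv_into H \<theta> v)) else undefined"
  have \<theta>: "\<theta> u \<notin> H" "inv_into H \<theta> (\<theta> u) = u" if "u \<in> H" for u
    using that disj inj by auto
  show ?thesis
  proof (rule sum.reindex_bij_witness[where i = ?i and j = "\<lambda>\<sigma>. \<lambda>u\<in>H. (\<sigma> u, \<sigma> (\<theta> u))"])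
    fix \<sigma> assume \<sigma>: "\<sigma> \<in> H \<union> \<theta> ` H \<rightarrow>\<^sub>E S"
    show "?i (\<lambda>u\<in>H. (\<sigma> u, \<sigma> (\<theta> u))) = \<sigma>"
    proof
      fix v
      consider "v \<in> H" | u where "u \<in> H" "v = \<theta> u" "v \<notin> H" | "v \<notin> H \<union> \<theta> ` H"
        by blast
      then show "?i (\<lambda>u\<in>H. (\<sigma> u, \<sigma> (\<theta> u))) v = \<sigma> v"
        by cases (use \<theta> PiE_arb[OF \<sigma>] in auto)
    qed
    show "(\<lambda>u\<in>H. (\<sigma> u, \<sigma> (\<theta> u))) \<in> H \<rightarrow>\<^sub>E S \<times> S"
      using \<sigma> by (auto simp: PiE_iff)
  next
    fix p assume p: "p \<in> H \<rightarrow>\<^sub>E S \<times> S"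
    show "(\<lambda>u\<in>H. (?i p u, ?i p (\<theta> u))) = p"
      using \<theta> PiE_arb[OF p] by (auto simp: fun_eq_iff restrict_def)
    have pS: "fst (p u) \<in> S" "snd (p u) \<in> S" if "u \<in> H" for u
      using p that by (auto simp: PiE_iff mem_Times_iff)
    show "?i p \<in> H \<union> \<theta> ` H \<rightarrow>\<^sub>E S"
      using \<theta> pS by (auto simp: PiE_iff extensional_def)
  qed simp
qed

text \<open>
  Folding \<open>H \<union> \<theta> ` H\<close> along the mirror: the bonds across it become interactions at single sites.
\<close>

lemma energy_fold:
  assumes H: "finite H" and E: "edges_in E H" and B: "B \<subseteq> H"
    and inj: "inj_on \<theta> H" and disj: "\<theta> ` H \<inter> H = {}"
  shows "energy (E \<union> (`) \<theta> ` E \<union> (\<lambda>u. {u, \<theta> u}) ` B) \<sigma>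
    = energy E \<sigma> + energy E (\<lambda>u. \<sigma> (\<theta> u)) + (\<Sum>u\<in>B. \<sigma> u * \<sigma> (\<theta> u))"
proof -
  have fE: "finite E" using E by (simp add: edges_in_def)
  have fB: "finite B" using H B finite_subset by blast
  have sub: "e \<subseteq> H" "e \<noteq> {}" if "e \<in> E" for e
    using edges_in_subset[OF E that] edges_inE[OF E that] by blast+
  have \<theta>: "\<theta> u \<notin> H" if "u \<in> H" for u
    using that disj by auto
  have d1: "E \<inter> (`) \<theta> ` E = {}"
  proof -
    have "\<theta> ` e \<notin> E" if "e \<in> E" for e
      using sub[OF that] sub(1)[of "\<theta> ` e"] \<theta> by blast
    then show ?thesis by blast
  qed
  have d2: "(E \<union> (`) \<theta> ` E) \<inter> (\<lambda>u. {u, \<theta> u}) ` B = {}"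
  proof -
    have "{u, \<theta> u} \<notin> E" if "u \<in> B" for u
      using that B sub(1)[of "{u, \<theta> u}"] \<theta>[of u] by auto
    moreover have "{u, \<theta> u} \<noteq> \<theta> ` e" if "u \<in> B" "e \<in> E" for u e
    proof
      assume "{u, \<theta> u} = \<theta> ` e"
      then have "u \<in> \<theta> ` e" by blast
      then show False using \<theta> that B sub(1)[OF that(2)] by blast
    qed
    ultimately show ?thesis by blast
  qed
  have i1: "inj_on ((`) \<theta>) E"
    by (rule inj_on_subset[OF inj_on_image_Pow[OF inj]]) (use sub in blast)
  have i2: "inj_on (\<lambda>u. {u, \<theta> u}) B"
  proof (rule inj_onI)
    fix u v assume uv: "u \<in> B" "v \<in> B" "{u, \<theta> u} = {v, \<theta> v}"
    then have "u = v \<or> u = \<theta> v" by blast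
    then show "u = v" using \<theta> uv B by blast
  qed
  have "energy (E \<union> (`) \<theta> ` E \<union> (\<lambda>u. {u, \<theta> u}) ` B) \<sigma>
      = energy E \<sigma> + (\<Sum>e\<in>(`) \<theta> ` E. \<Prod>x\<in>e. \<sigma> x) + (\<Sum>e\<in>(\<lambda>u. {u, \<theta> u}) ` B. \<Prod>x\<in>e. \<sigma> x)"
    unfolding energy_def using fE fB d1 d2 by (simp add: sum.union_disjoint)
  also have "(\<Sum>e\<in>(`) \<theta> ` E. \<Prod>x\<in>e. \<sigma> x) = energy E (\<lambda>u. \<sigma> (\<theta> u))"
    unfolding energy_def sum.reindex[OF i1] o_def
  proof (rule sum.cong[OF refl])
    fix e assume "e \<in> E"
    then have "inj_on \<theta> e" using sub inj inj_on_subset by blast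
    then show "(\<Prod>x\<in>\<theta> ` e. \<sigma> x) = (\<Prod>x\<in>e. \<sigma> (\<theta> x))"
      by (simp add: prod.reindex)
  qed
  also have "(\<Sum>e\<in>(\<lambda>u. {u, \<theta> u}) ` B. \<Prod>x\<in>e. \<sigma> x) = (\<Sum>u\<in>B. \<sigma> u * \<sigma> (\<theta> u))"
    unfolding sum.reindex[OF i2] o_def
  proof (rule sum.cong[OF refl])
    fix u assume "u \<in> B"
    then have "u \<noteq> \<theta> u" using \<theta> B by force
    then show "(\<Prod>x\<in>{u, \<theta> u}. \<sigma> x) = \<sigma> u * \<sigma> (\<theta> u)" by simp
  qed
  finally show ?thesis .
qed

text \<open>
  After folding, the left-hand side is the expectation of \<open>t\<^sub>x t\<^sub>y\<close> for the model on \<open>V\<close>. Four copies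
  bound it by the expectation of \<open>(\<sigma> - \<tau>)\<^sub>x (\<sigma> - \<tau>)\<^sub>y\<close> for two independent copies on \<open>H\<close>, which is
  \<open>2 \<langle>\<sigma>\<^sub>x \<sigma>\<^sub>y\<rangle> - 2 \<langle>\<sigma>\<^sub>x\<rangle> \<langle>\<sigma>\<^sub>y\<rangle>\<close>; the last product is nonnegative by Griffiths' first inequality.
\<close>

lemma reflection_inequality:
  assumes H: "finite H" and E: "edges_in E H" and B: "B \<subseteq> H" and \<beta>: "0 \<le> \<beta>"
    and inj: "inj_on \<theta> H" and disj: "\<theta> ` H \<inter> H = {}" and xy: "x \<in> H" "y \<in> H"
    and V: "V = H \<union> \<theta> ` H" and F: "F = E \<union> (`) \<theta> ` E \<union> (\<lambda>u. {u, \<theta> u}) ` B"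
  shows "corr V F \<beta> x y + corr V F \<beta> (\<theta> x) (\<theta> y) - corr V F \<beta> x (\<theta> y) - corr V F \<beta> (\<theta> x) y
    \<le> 2 * corr H E \<beta> x y"
proof -
  let ?P = "H \<rightarrow>\<^sub>E {-1, 1} \<times> {-1, 1::real}"
  define t where "t = (\<lambda>(p :: 'a \<Rightarrow> real \<times> real) u. fst (p u) - snd (p u))"
  define W where "W = (\<lambda>p. exp (\<beta> * (energy E (\<lambda>u. fst (p u)) + energy E (\<lambda>u. snd (p u)))))"
  define X where "X = (\<lambda>p. exp (\<beta> * (\<Sum>u\<in>B. fst (p u) * snd (p u :: real \<times> real))))"
  let ?Z = "spin_sum H E \<beta> (\<lambda>_. 1)" and ?ZV = "spin_sum V F \<beta> (\<lambda>_. 1)"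
  let ?A = "\<Sum>p\<in>?P. t p x * t p y * (W p * X p)" and ?D = "\<Sum>p\<in>?P. t p x * t p y * W p"
  note Z = spin_sum_one_pos[OF H, of E \<beta>]
  have ZV: "0 < ?ZV" by (rule spin_sum_one_pos) (use H V in simp)
  have fold: "spin_sum V F \<beta> (\<lambda>\<sigma>. g (\<lambda>u\<in>H. (\<sigma> u, \<sigma> (\<theta> u)))) = (\<Sum>p\<in>?P. g p * (W p * X p))" for g
  proof -
    have "spin_sum V F \<beta> (\<lambda>\<sigma>. g (\<lambda>u\<in>H. (\<sigma> u, \<sigma> (\<theta> u)))) = (\<Sum>\<sigma>\<in>H \<union> \<theta> ` H \<rightarrow>\<^sub>E {-1, 1}.
        (\<lambda>p. g p * (W p * X p)) (\<lambda>u\<in>H. (\<sigma> u, \<sigma> (\<theta> u))))"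
      unfolding spin_sum_def V
    proof (rule sum.cong[OF refl])
      fix \<sigma> :: "'a \<Rightarrow> real"
      let ?p = "\<lambda>u\<in>H. (\<sigma> u, \<sigma> (\<theta> u))"
      have "energy E (\<lambda>u. fst (?p u)) = energy E \<sigma>" "energy E (\<lambda>u. snd (?p u)) = energy E (\<lambda>u. \<sigma> (\<theta> u))"
        by (rule energy_cong[OF E], simp)+
      moreover have "(\<Sum>u\<in>B. fst (?p u) * snd (?p u)) = (\<Sum>u\<in>B. \<sigma> u * \<sigma> (\<theta> u))"
        using B by (intro sum.cong) auto
      ultimately have "exp (\<beta> * energy F \<sigma>) = W ?p * X ?p"
        unfolding F energy_fold[OF H E B inj disj] W_def X_def
        by (simp add: exp_add[symmetric] distrib_left)
      then show "g ?p * exp (\<beta> * energy F \<sigma>) = (\<lambda>p. g p * (W p * X p)) ?p" by simp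
    qed
    also have "\<dots> = (\<Sum>p\<in>?P. g p * (W p * X p))"
      by (rule sum_PiE_fold[OF inj disj])
    finally show ?thesis .
  qed
  have ZV_eq: "?ZV = (\<Sum>p\<in>?P. W p * X p)"
    using fold[of "\<lambda>_. 1"] by simp
  have A_eq: "?A = (corr V F \<beta> x y + corr V F \<beta> (\<theta> x) (\<theta> y) - corr V F \<beta> x (\<theta> y) - corr V F \<beta> (\<theta> x) y) * ?ZV"
  proof -
    have "?A = spin_sum V F \<beta> (\<lambda>\<sigma>. (\<sigma> x - \<sigma> (\<theta> x)) * (\<sigma> y - \<sigma> (\<theta> y)))"
      using fold[of "\<lambda>p. t p x * t p y"] xy by (simp add: t_def)
    also have "\<dots> = spin_sum V F \<beta> (\<lambda>\<sigma>. \<sigma> x * \<sigma> y) + spin_sum V F \<beta> (\<lambda>\<sigma>. \<sigma> (\<theta> x) * \<sigma> (\<theta> y))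
        - spin_sum V F \<beta> (\<lambda>\<sigma>. \<sigma> x * \<sigma> (\<theta> y)) - spin_sum V F \<beta> (\<lambda>\<sigma>. \<sigma> (\<theta> x) * \<sigma> y)"
      unfolding spin_sum_def
      by (simp add: algebra_simps sum.distrib sum_subtractf)
    finally show ?thesis
      using ZV unfolding corr_def add_divide_distrib[symmetric] diff_divide_distrib[symmetric]
      by simp
  qed
  have pair: "(\<Sum>p\<in>?P. g (\<lambda>u\<in>H. fst (p u)) (\<lambda>u\<in>H. snd (p u)) * W p)
      = (\<Sum>\<sigma>\<in>H \<rightarrow>\<^sub>E {-1, 1}. \<Sum>\<tau>\<in>H \<rightarrow>\<^sub>E {-1, 1}. g \<sigma> \<tau> * exp (\<beta> * (energy E \<sigma> + energy E \<tau>)))" for g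
    unfolding W_def
    by (subst sum_PiE_Times[symmetric]) (simp add: energy_restrict[OF E])
  have ZZ: "(\<Sum>p\<in>?P. W p) = ?Z * ?Z"
    using pair[of "\<lambda>_ _. 1 * 1"] unfolding spin_sum_product by simp
  have D: "?D \<le> 2 * corr H E \<beta> x y * (?Z * ?Z)"
  proof -
    let ?g = "\<lambda>\<sigma> \<tau>. \<sigma> x * \<sigma> y * 1 + 1 * (\<tau> x * \<tau> y) - \<sigma> x * \<tau> y - \<sigma> y * \<tau> x"
    have "?D = (\<Sum>p\<in>?P. ?g (\<lambda>u\<in>H. fst (p u)) (\<lambda>u\<in>H. snd (p u)) * W p)"
      using xy by (simp add: t_def algebra_simps)
    also have "\<dots> = (\<Sum>\<sigma>\<in>H \<rightarrow>\<^sub>E {-1, 1}. \<Sum>\<tau>\<in>H \<rightarrow>\<^sub>E {-1, 1}.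
        ?g \<sigma> \<tau> * exp (\<beta> * (energy E \<sigma> + energy E \<tau>)))"
      by (rule pair[of ?g])
    also have "\<dots> = spin_sum H E \<beta> (\<lambda>\<sigma>. \<sigma> x * \<sigma> y) * ?Z + ?Z * spin_sum H E \<beta> (\<lambda>\<sigma>. \<sigma> x * \<sigma> y)
        - spin_sum H E \<beta> (\<lambda>\<sigma>. \<sigma> x) * spin_sum H E \<beta> (\<lambda>\<sigma>. \<sigma> y)
        - spin_sum H E \<beta> (\<lambda>\<sigma>. \<sigma> y) * spin_sum H E \<beta> (\<lambda>\<sigma>. \<sigma> x)"
      unfolding left_diff_distrib distrib_right sum_subtractf sum.distrib spin_sum_product ..
    also have "\<dots> \<le> 2 * spin_sum H E \<beta> (\<lambda>\<sigma>. \<sigma> x * \<sigma> y) * ?Z"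
      using mult_nonneg_nonneg[OF griffiths_first(1)[OF H E \<beta> xy] griffiths_first(1)[OF H E \<beta> xy(2) xy(1)]]
      by (simp add: mult.commute)
    also have "\<dots> = 2 * corr H E \<beta> x y * (?Z * ?Z)"
      using Z unfolding corr_def by simp
    finally show ?thesis .
  qed
  have "0 \<le> (\<Sum>p\<in>?P. \<Sum>q\<in>?P. (t q x * t q y - t p x * t p y) * (W p * X p * W q))"
    using reflection_four_copies[OF H E B \<beta> xy] unfolding t_def W_def X_def .
  also have "\<dots> = (\<Sum>p\<in>?P. W p * X p) * ?D - ?A * (\<Sum>p\<in>?P. W p)"
    unfolding sum_product sum_subtractf[symmetric]
    by (intro sum.cong refl) (simp add: algebra_simps)
  finally have "?A * (?Z * ?Z) \<le> ?ZV * ?D" unfolding ZZ ZV_eq by simp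
  also have "\<dots> \<le> ?ZV * (2 * corr H E \<beta> x y * (?Z * ?Z))"
    using D ZV by (intro mult_left_mono) auto
  finally have "?A * (?Z * ?Z) \<le> (2 * corr H E \<beta> x y * ?ZV) * (?Z * ?Z)" by (simp add: mult_ac)
  then have "?A \<le> 2 * corr H E \<beta> x y * ?ZV"
    using Z by (simp add: mult_le_cancel_right)
  then show ?thesis unfolding A_eq using ZV by simp
qed

section \<open>Symmetries of correlations\<close>

lemma corr_transport:
  assumes E: "edges_in E V" and bij: "bij_betw g V V" and img: "(`) g ` E = E" and xy: "x \<in> V" "y \<in> V"
  shows "corr V E \<beta> (g x) (g y) = corr V E \<beta> x y"
proof -
  have inj: "inj_on g V" and gV: "g ` V = V" using bij by (auto simp: bij_betw_def)
  have i1: "inj_on ((`) g) E"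
    by (rule inj_on_subset[OF inj_on_image_Pow[OF inj]]) (use edges_in_subset[OF E] in blast)
  have en: "energy E (\<lambda>u. \<sigma> (g u)) = energy E \<sigma>" for \<sigma>
  proof -
    have "energy E \<sigma> = (\<Sum>e\<in>(`) g ` E. \<Prod>x\<in>e. \<sigma> x)" unfolding energy_def img ..
    also have "\<dots> = (\<Sum>e\<in>E. \<Prod>x\<in>g ` e. \<sigma> x)" by (simp add: sum.reindex[OF i1])
    also have "\<dots> = energy E (\<lambda>u. \<sigma> (g u))" unfolding energy_def
    proof (rule sum.cong[OF refl])
      fix e assume "e \<in> E"
      then have "inj_on g e" using edges_in_subset[OF E] inj inj_on_subset by blast
      then show "(\<Prod>x\<in>g ` e. \<sigma> x) = (\<Prod>x\<in>e. \<sigma> (g x))" by (simp add: prod.reindex)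
    qed
    finally show ?thesis ..
  qed
  let ?S = "{-1, 1::real}" and ?j = "\<lambda>\<sigma>. \<lambda>u\<in>V. \<sigma> (g u)" and ?i = "\<lambda>\<sigma>. \<lambda>u\<in>V. \<sigma> (inv_into V g u)"
  have g: "g u \<in> V" "inv_into V g (g u) = u" "inv_into V g u \<in> V" "g (inv_into V g u) = u" if "u \<in> V" for u
    using that gV inj inv_into_into[of u g V] f_inv_into_f[of u g V] by auto
  have "spin_sum V E \<beta> (\<lambda>\<sigma>. \<sigma> (g x) * \<sigma> (g y)) = spin_sum V E \<beta> (\<lambda>\<sigma>. \<sigma> x * \<sigma> y)"
    unfolding spin_sum_def
  proof (rule sum.reindex_bij_witness[where i = ?i and j = ?j])
    fix \<sigma> assume \<sigma>: "\<sigma> \<in> V \<rightarrow>\<^sub>E ?S"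
    show "?i (?j \<sigma>) = \<sigma>" "?j (?i \<sigma>) = \<sigma>"
      using g PiE_arb[OF \<sigma>] by (auto simp: fun_eq_iff restrict_def)
    show "?j \<sigma> \<in> V \<rightarrow>\<^sub>E ?S" "?i \<sigma> \<in> V \<rightarrow>\<^sub>E ?S"
      using g \<sigma> by (simp_all add: PiE_iff)
    show "?j \<sigma> x * ?j \<sigma> y * exp (\<beta> * energy E (?j \<sigma>)) = \<sigma> (g x) * \<sigma> (g y) * exp (\<beta> * energy E \<sigma>)"
      using xy by (simp add: energy_restrict[OF E] en)
  qed
  then show ?thesis unfolding corr_def by simp
qed

text \<open>
  On a bipartite graph, negating the spins of one class turns the antiferromagnet into the ferromagnet.
\<close>

lemma corr_sublattice_flip:
  assumes E: "edges_in E V" and \<epsilon>: "\<And>v. v \<in> V \<Longrightarrow> \<epsilon> v \<in> {-1, 1}"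
    and alt: "\<And>e. e \<in> E \<Longrightarrow> (\<Prod>v\<in>e. \<epsilon> v) = -1" and xy: "x \<in> V" "y \<in> V"
  shows "corr V E \<beta> x y = \<epsilon> x * \<epsilon> y * corr V E (- \<beta>) x y"
proof -
  let ?S = "{-1, 1::real}" and ?j = "\<lambda>\<sigma>. \<lambda>v\<in>V. \<epsilon> v * \<sigma> v"
  have sq: "\<epsilon> v * (\<epsilon> v * a) = a" if "v \<in> V" for v a using \<epsilon>[OF that] by auto
  have en: "energy E (?j \<sigma>) = - energy E \<sigma>" for \<sigma>
    unfolding energy_restrict[OF E] unfolding energy_def
    by (simp add: prod.distrib alt sum_negf)
  have flip: "spin_sum V E \<beta> f = spin_sum V E (- \<beta>) (\<lambda>\<sigma>. f (?j \<sigma>))" for f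
    unfolding spin_sum_def
  proof (rule sum.reindex_bij_witness[where i = ?j and j = ?j])
    fix \<sigma> assume \<sigma>: "\<sigma> \<in> V \<rightarrow>\<^sub>E ?S"
    show inv: "?j (?j \<sigma>) = \<sigma>"
      using sq PiE_arb[OF \<sigma>] by (auto simp: fun_eq_iff restrict_def)
    show "?j \<sigma> \<in> V \<rightarrow>\<^sub>E ?S"
    proof (rule PiE_I)
      fix v assume "v \<in> V"
      then have "\<epsilon> v \<in> ?S" "\<sigma> v \<in> ?S" using \<epsilon> \<sigma> by (auto simp: PiE_iff)
      then show "?j \<sigma> v \<in> ?S" using \<open>v \<in> V\<close> by auto
    qed simp
    show "f (?j (?j \<sigma>)) * exp (- \<beta> * energy E (?j \<sigma>)) = f \<sigma> * exp (\<beta> * energy E \<sigma>)"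
      unfolding inv en by simp
    show "?j (?j \<sigma>) = \<sigma>" by fact
    show "?j \<sigma> \<in> V \<rightarrow>\<^sub>E ?S" by fact
  qed
  have "spin_sum V E \<beta> (\<lambda>\<sigma>. \<sigma> x * \<sigma> y) = \<epsilon> x * \<epsilon> y * spin_sum V E (- \<beta>) (\<lambda>\<sigma>. \<sigma> x * \<sigma> y)"
    unfolding flip[of "\<lambda>\<sigma>. \<sigma> x * \<sigma> y"] using xy
    by (simp add: spin_sum_def sum_distrib_left mult_ac)
  moreover have "spin_sum V E \<beta> (\<lambda>_. 1) = spin_sum V E (- \<beta>) (\<lambda>_. 1)"
    unfolding flip[of "\<lambda>_. 1"] by simp
  ultimately show ?thesis unfolding corr_def by simp
qed
section \<open>The free Ising model on the lattice\<close>

definition free_corr :: "(int ^ 'd) set \<Rightarrow> real \<Rightarrow> int ^ 'd \<Rightarrow> int ^ 'd \<Rightarrow> real" where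
  "free_corr \<Lambda> \<beta> x y = free_expectation \<Lambda> \<beta> 0 (\<lambda>\<sigma>. \<sigma> x * \<sigma> y)"

lemma free_corr_eq_corr: "free_corr \<Lambda> \<beta> x y = corr \<Lambda> (free_edges \<Lambda>) \<beta> x y"
  unfolding free_corr_def free_expectation_def free_prob_def free_partition_def free_configs_def
    boltzmann_weight_def corr_def spin_sum_def energy_def
  by (simp add: sum_divide_distrib)

lemma doubleton_nn_edges_iff: "{x, y} \<in> nn_edges \<longleftrightarrow> (\<Sum>i\<in>UNIV. \<bar>x $ i - y $ i\<bar>) = 1"
proof
  assume "{x, y} \<in> nn_edges"
  then obtain u v where "{x, y} = {u, v}" and uv: "(\<Sum>i\<in>UNIV. \<bar>u $ i - v $ i\<bar>) = 1"
    unfolding nn_edges_def by blast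
  then have "x = u \<and> y = v \<or> x = v \<and> y = u" by (simp add: doubleton_eq_iff)
  then show "(\<Sum>i\<in>UNIV. \<bar>x $ i - y $ i\<bar>) = 1" using uv by (auto simp: abs_minus_commute)
qed (auto simp: nn_edges_def)

lemma nn_edgesE:
  assumes "e \<in> nn_edges"
  obtains x y where "e = {x, y}" "x \<noteq> y" "(\<Sum>i\<in>UNIV. \<bar>x $ i - y $ i\<bar>) = 1"
proof -
  obtain x y where *: "e = {x, y}" "(\<Sum>i\<in>UNIV. \<bar>x $ i - y $ i\<bar>) = 1"
    using assms unfolding nn_edges_def by blast
  moreover from *(2) have "x \<noteq> y" by auto
  ultimately show ?thesis using that by blast
qed

lemma edges_in_free_edges:
  assumes "finite \<Lambda>"
  shows "edges_in (free_edges \<Lambda>) \<Lambda>"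
  unfolding edges_in_def
proof
  show "finite (free_edges \<Lambda>)"
    by (rule finite_subset[of _ "Pow \<Lambda>"]) (use assms in \<open>auto simp: free_edges_def\<close>)
  show "\<forall>e\<in>free_edges \<Lambda>. \<exists>u\<in>\<Lambda>. \<exists>v\<in>\<Lambda>. u \<noteq> v \<and> e = {u, v}"
  proof
    fix e assume e: "e \<in> free_edges \<Lambda>"
    then obtain x y where "e = {x, y}" "x \<noteq> y" unfolding free_edges_def by (blast elim: nn_edgesE)
    then show "\<exists>u\<in>\<Lambda>. \<exists>v\<in>\<Lambda>. u \<noteq> v \<and> e = {u, v}" using e by (auto simp: free_edges_def)
  qed
qed

lemma free_corr_mono:
  assumes "finite \<Lambda>'" "\<Lambda> \<subseteq> \<Lambda>'" "0 \<le> \<beta>" "x \<in> \<Lambda>" "y \<in> \<Lambda>"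
  shows "free_corr \<Lambda> \<beta> x y \<le> free_corr \<Lambda>' \<beta> x y"
  unfolding free_corr_eq_corr
proof (rule corr_mono)
  show "free_edges \<Lambda> \<subseteq> free_edges \<Lambda>'" using assms(2) by (auto simp: free_edges_def)
  show "edges_in (free_edges \<Lambda>) \<Lambda>" "edges_in (free_edges \<Lambda>') \<Lambda>'"
    using assms finite_subset by (blast intro: edges_in_free_edges)+
qed (use assms in auto)

lemma free_corr_nonneg:
  assumes "finite \<Lambda>" "0 \<le> \<beta>" "x \<in> \<Lambda>" "y \<in> \<Lambda>"
  shows "0 \<le> free_corr \<Lambda> \<beta> x y"
  unfolding free_corr_eq_corr corr_def
  by (intro divide_nonneg_pos griffiths_first spin_sum_one_pos edges_in_free_edges assms)

lemma free_corr_le_1: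
  assumes "finite \<Lambda>" "x \<in> \<Lambda>" "y \<in> \<Lambda>"
  shows "free_corr \<Lambda> \<beta> x y \<le> 1"
proof -
  have "spin_sum \<Lambda> (free_edges \<Lambda>) \<beta> (\<lambda>\<sigma>. \<sigma> x * \<sigma> y) \<le> spin_sum \<Lambda> (free_edges \<Lambda>) \<beta> (\<lambda>_. 1)"
    unfolding spin_sum_def
  proof (intro sum_mono mult_right_mono)
    fix \<sigma> assume "\<sigma> \<in> \<Lambda> \<rightarrow>\<^sub>E {-1, 1::real}"
    then have "\<sigma> x \<in> {-1, 1}" "\<sigma> y \<in> {-1, 1}" using assms by (auto simp: PiE_iff)
    then show "\<sigma> x * \<sigma> y \<le> 1" by auto
  qed simp
  then show ?thesis unfolding free_corr_eq_corr corr_def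
    using spin_sum_one_pos[OF assms(1)] by (simp add: divide_le_eq)
qed

text \<open>
  By monotonicity the net converges to the supremum over the finite volumes that contain both sites.
  The restriction to such volumes matters: a spin outside the volume has an unspecified value.
\<close>

lemma free_corr_limit:
  fixes x y :: "int ^ 'd"
  assumes \<beta>: "0 \<le> \<beta>"
  obtains L where "((\<lambda>\<Lambda>. free_corr \<Lambda> \<beta> x y) \<longlongrightarrow> L) (finite_subsets_at_top UNIV)"
    and "\<And>\<Lambda>. finite \<Lambda> \<Longrightarrow> x \<in> \<Lambda> \<Longrightarrow> y \<in> \<Lambda> \<Longrightarrow> free_corr \<Lambda> \<beta> x y \<le> L"
    and "\<And>r. r < L \<Longrightarrow> \<exists>\<Lambda>. finite \<Lambda> \<and> x \<in> \<Lambda> \<and> y \<in> \<Lambda> \<and> r < free_corr \<Lambda> \<beta> x y"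
proof -
  define A where "A = {\<Lambda>. finite \<Lambda> \<and> x \<in> \<Lambda> \<and> y \<in> \<Lambda>}"
  let ?f = "\<lambda>\<Lambda>. free_corr \<Lambda> \<beta> x y"
  define L where "L = (SUP \<Lambda>\<in>A. ?f \<Lambda>)"
  have A: "A \<noteq> {}" by (auto simp: A_def intro: exI[of _ "{x, y}"])
  have bdd: "bdd_above (?f ` A)"
    by (rule bdd_aboveI[of _ 1]) (auto simp: A_def free_corr_le_1)
  have upper: "?f \<Lambda> \<le> L" if "finite \<Lambda>" "x \<in> \<Lambda>" "y \<in> \<Lambda>" for \<Lambda>
    unfolding L_def by (rule cSUP_upper[OF _ bdd]) (use that in \<open>simp add: A_def\<close>)
  have lower: "\<exists>\<Lambda>. finite \<Lambda> \<and> x \<in> \<Lambda> \<and> y \<in> \<Lambda> \<and> r < ?f \<Lambda>" if "r < L" for r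
    using that less_cSUP_iff[OF A bdd] unfolding L_def by (auto simp: A_def)
  have "(?f \<longlongrightarrow> L) (finite_subsets_at_top UNIV)"
  proof (rule order_tendstoI)
    fix r assume "r < L"
    then obtain \<Lambda> where \<Lambda>: "finite \<Lambda>" "x \<in> \<Lambda>" "y \<in> \<Lambda>" "r < ?f \<Lambda>" using lower by blast
    then have "r < ?f \<Lambda>'" if "finite \<Lambda>'" "\<Lambda> \<subseteq> \<Lambda>'" for \<Lambda>'
      using free_corr_mono[OF that \<beta>, of x y] by simp
    then show "\<forall>\<^sub>F \<Lambda> in finite_subsets_at_top UNIV. r < ?f \<Lambda>"
      unfolding eventually_finite_subsets_at_top using \<Lambda>(1) by blast
  next
    fix r assume "L < r"
    then have "?f \<Lambda> < r" if "finite \<Lambda>" "{x, y} \<subseteq> \<Lambda>" for \<Lambda>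
      using upper[of \<Lambda>] that by simp
    then show "\<forall>\<^sub>F \<Lambda> in finite_subsets_at_top UNIV. ?f \<Lambda> < r"
      unfolding eventually_finite_subsets_at_top by (intro exI[of _ "{x, y}"]) blast
  qed
  from that[OF this upper lower] show ?thesis .
qed

lemma even_sum_abs_iff:
  fixes f :: "'a \<Rightarrow> int"
  shows "even (\<Sum>i\<in>A. \<bar>f i\<bar>) \<longleftrightarrow> even (\<Sum>i\<in>A. f i)"
  by (induction A rule: infinite_finite_induct) auto

lemma free_corr_uminus_neighbours:
  assumes \<Lambda>: "finite \<Lambda>" and xy: "x \<in> \<Lambda>" "y \<in> \<Lambda>" "{x, y} \<in> nn_edges"
  shows "free_corr \<Lambda> \<beta> x y = - free_corr \<Lambda> (- \<beta>) x y"
proof -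
  \<comment> \<open>The two sublattices are the sites of even and of odd coordinate sum.\<close>
  define \<epsilon> :: "int ^ 'a \<Rightarrow> real" where "\<epsilon> = (\<lambda>v. if even (\<Sum>i\<in>UNIV. v $ i) then 1 else -1)"
  have alt: "\<epsilon> u * \<epsilon> v = -1" if "(\<Sum>i\<in>UNIV. \<bar>u $ i - v $ i\<bar>) = 1" for u v
  proof -
    have "odd (\<Sum>i\<in>UNIV. \<bar>u $ i - v $ i\<bar>)" unfolding that by simp
    then have "odd ((\<Sum>i\<in>UNIV. u $ i) - (\<Sum>i\<in>UNIV. v $ i))"
      unfolding even_sum_abs_iff by (simp add: sum_subtractf)
    then show ?thesis by (auto simp: \<epsilon>_def)
  qed
  have "corr \<Lambda> (free_edges \<Lambda>) \<beta> x y = \<epsilon> x * \<epsilon> y * corr \<Lambda> (free_edges \<Lambda>) (- \<beta>) x y"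
  proof (rule corr_sublattice_flip[OF edges_in_free_edges[OF \<Lambda>]])
    fix e assume "e \<in> free_edges \<Lambda>"
    then obtain u v where "e = {u, v}" "u \<noteq> v" "(\<Sum>i\<in>UNIV. \<bar>u $ i - v $ i\<bar>) = 1"
      unfolding free_edges_def by (blast elim: nn_edgesE)
    then show "(\<Prod>v\<in>e. \<epsilon> v) = -1" using alt by simp
  qed (use xy in \<open>auto simp: \<epsilon>_def\<close>)
  then show ?thesis
    using alt[of x y] xy(3) unfolding free_corr_eq_corr doubleton_nn_edges_iff by simp
qed

text \<open>
  Neighbours lie in different sublattices, so their correlation at \<open>\<beta>\<close> is minus the one at \<open>- \<beta>\<close>, which
  has a nonnegative limit.
\<close>

lemma Lim_free_corr_neighbours_nonpos:
  assumes \<beta>: "\<beta> \<le> 0" and xy: "{x, y} \<in> nn_edges"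
  shows "Lim (finite_subsets_at_top UNIV) (\<lambda>\<Lambda>. free_corr \<Lambda> \<beta> x y) \<le> 0"
proof -
  obtain L where L: "((\<lambda>\<Lambda>. free_corr \<Lambda> (- \<beta>) x y) \<longlongrightarrow> L) (finite_subsets_at_top UNIV)"
    and le: "\<And>\<Lambda>. finite \<Lambda> \<Longrightarrow> x \<in> \<Lambda> \<Longrightarrow> y \<in> \<Lambda> \<Longrightarrow> free_corr \<Lambda> (- \<beta>) x y \<le> L"
    by (rule free_corr_limit[of "- \<beta>" x y]) (use \<beta> in auto)
  have ev: "\<forall>\<^sub>F \<Lambda> in finite_subsets_at_top UNIV. - free_corr \<Lambda> (- \<beta>) x y = free_corr \<Lambda> \<beta> x y"
    unfolding eventually_finite_subsets_at_top
  proof (intro exI[of _ "{x, y}"] conjI allI impI)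
    fix \<Lambda> :: "(int ^ 'a) set"
    assume "finite \<Lambda> \<and> {x, y} \<subseteq> \<Lambda> \<and> \<Lambda> \<subseteq> UNIV"
    then have "free_corr \<Lambda> \<beta> x y = - free_corr \<Lambda> (- \<beta>) x y"
      by (intro free_corr_uminus_neighbours xy) auto
    then show "- free_corr \<Lambda> (- \<beta>) x y = free_corr \<Lambda> \<beta> x y" by linarith
  qed auto
  have "((\<lambda>\<Lambda>. free_corr \<Lambda> \<beta> x y) \<longlongrightarrow> - L) (finite_subsets_at_top UNIV)"
    by (rule Lim_transform_eventually[OF tendsto_minus[OF L] ev])
  then have "Lim (finite_subsets_at_top UNIV) (\<lambda>\<Lambda>. free_corr \<Lambda> \<beta> x y) = - L"
    by (intro tendsto_Lim) auto
  moreover have "0 \<le> L"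
    using free_corr_nonneg[of "{x, y}" "- \<beta>" x y] le[of "{x, y}"] \<beta> by simp
  ultimately show ?thesis by simp
qed

section \<open>Reflections of the lattice\<close>

text \<open>
  The mirror is the hyperplane where the \<open>i\<close>-th coordinate is \<open>b + 1/2\<close>.
\<close>

definition reflect :: "'d \<Rightarrow> int \<Rightarrow> int ^ 'd \<Rightarrow> int ^ 'd" where
  "reflect i b x = (\<chi> j. if j = i then 2 * b + 1 - x $ i else x $ j)"

lemma reflect_nth [simp]:
  "reflect i b x $ i = 2 * b + 1 - x $ i"
  "j \<noteq> i \<Longrightarrow> reflect i b x $ j = x $ j"
  by (simp_all add: reflect_def)

lemma reflect_reflect [simp]: "reflect i b (reflect i b x) = x"
  by (simp add: reflect_def vec_eq_iff)

lemma reflect_image_nn_edges: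
  assumes "e \<in> nn_edges"
  shows "reflect i b ` e \<in> nn_edges"
proof -
  obtain x y where e: "e = {x, y}" "(\<Sum>j\<in>UNIV. \<bar>x $ j - y $ j\<bar>) = 1"
    using nn_edgesE[OF assms] .
  have "(\<Sum>j\<in>UNIV. \<bar>reflect i b x $ j - reflect i b y $ j\<bar>) = (\<Sum>j\<in>UNIV. \<bar>x $ j - y $ j\<bar>)"
    by (rule sum.cong[OF refl]) (auto simp: reflect_def)
  then show ?thesis using e by (simp add: doubleton_nn_edges_iff)
qed

text \<open>
  The coordinate step across the mirror already uses up the whole length of the bond.
\<close>

lemma nn_edge_across_mirror:
  fixes x y :: "int ^ 'd"
  assumes xy: "(\<Sum>j\<in>UNIV. \<bar>x $ j - y $ j\<bar>) = 1" and "x $ i \<le> b" "b < y $ i"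
  shows "y = reflect i b x"
proof -
  have split: "\<bar>x $ i - y $ i\<bar> + (\<Sum>j\<in>UNIV - {i}. \<bar>x $ j - y $ j\<bar>) = 1"
    using xy by (simp add: sum.remove[of UNIV i])
  have "0 \<le> (\<Sum>j\<in>UNIV - {i}. \<bar>x $ j - y $ j\<bar>)" by (simp add: sum_nonneg)
  then have i: "x $ i = b" "y $ i = b + 1" and 0: "(\<Sum>j\<in>UNIV - {i}. \<bar>x $ j - y $ j\<bar>) = 0"
    using split assms by linarith+
  have "x $ j = y $ j" if "j \<noteq> i" for j
    using 0 that by (simp add: sum_nonneg_eq_0_iff)
  then show ?thesis using i by (simp add: vec_eq_iff reflect_def)
qed

text \<open>
  The bonds of \<open>V\<close> that cross the mirror join a site to its own image, and the others lie in \<open>H\<close> or in its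
  image, so \<open>reflection_inequality\<close> applies. Reflection invariance of the model on \<open>V\<close> identifies the
  four correlations on its left-hand side in pairs. The side \<open>H\<close> may be either half, as the faces of a
  box look both ways.
\<close>

lemma free_corr_reflection:
  assumes V: "finite V" and sym: "reflect i b ` V \<subseteq> V" and \<beta>: "0 \<le> \<beta>"
    and H: "H = {u \<in> V. u $ i \<le> b} \<or> H = {u \<in> V. b < u $ i}" and xy: "x \<in> H" "y \<in> H"
  shows "free_corr V \<beta> x y - free_corr V \<beta> x (reflect i b y) \<le> free_corr H \<beta> x y"
proof -
  let ?\<theta> = "reflect i b"
  define B where "B = {u \<in> H. {u, ?\<theta> u} \<in> nn_edges}"
  have \<theta>V: "?\<theta> u \<in> V" if "u \<in> V" for u using sym that by blast
  have HV: "H \<subseteq> V" using H by auto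
  have HI: "u \<in> H \<longleftrightarrow> ?\<theta> u \<notin> H" if "u \<in> V" for u
  proof -
    have "?\<theta> u $ i \<le> b \<longleftrightarrow> b < u $ i" by auto
    then show ?thesis using H that \<theta>V[OF that] by auto
  qed
  have V_eq: "V = H \<union> ?\<theta> ` H"
  proof (intro equalityI subsetI)
    fix u assume "u \<in> V"
    then show "u \<in> H \<union> ?\<theta> ` H"
      using HI[of u] image_eqI[of u ?\<theta> "?\<theta> u" H] by auto
  qed (use HV \<theta>V in auto)
  have disj: "?\<theta> ` H \<inter> H = {}" using HI HV by auto
  have inj: "inj_on ?\<theta> A" for A by (rule inj_onI) (metis reflect_reflect)
  have cross: "v = ?\<theta> u" if "u \<in> H" "v \<in> V" "v \<notin> H" "(\<Sum>j\<in>UNIV. \<bar>u $ j - v $ j\<bar>) = 1" for u v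
    using H
  proof
    assume "H = {u \<in> V. u $ i \<le> b}"
    then show ?thesis using nn_edge_across_mirror[of u v i b] that by auto
  next
    assume "H = {u \<in> V. b < u $ i}"
    then have "u = ?\<theta> v"
      using nn_edge_across_mirror[of v u i b] that by (auto simp: abs_minus_commute)
    then show ?thesis by simp
  qed
  have edges: "free_edges V = free_edges H \<union> (`) ?\<theta> ` free_edges H \<union> (\<lambda>u. {u, ?\<theta> u}) ` B"
  proof (intro equalityI subsetI)
    fix e assume "e \<in> free_edges V"
    then have e: "e \<in> nn_edges" "e \<subseteq> V" by (auto simp: free_edges_def)
    obtain u v where uv: "e = {u, v}" "(\<Sum>j\<in>UNIV. \<bar>u $ j - v $ j\<bar>) = 1" using nn_edgesE[OF e(1)] .
    have vu: "(\<Sum>j\<in>UNIV. \<bar>v $ j - u $ j\<bar>) = 1" using uv(2) by (simp add: abs_minus_commute)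
    consider "u \<in> H" "v \<in> H" | "u \<in> H" "v \<notin> H" | "u \<notin> H" "v \<in> H" | "u \<notin> H" "v \<notin> H" by blast
    then show "e \<in> free_edges H \<union> (`) ?\<theta> ` free_edges H \<union> (\<lambda>u. {u, ?\<theta> u}) ` B"
    proof cases
      case 1
      then show ?thesis using e uv by (simp add: free_edges_def)
    next
      case 2
      then have "v = ?\<theta> u" using cross e uv by auto
      then show ?thesis using e uv 2 by (simp add: B_def)
    next
      case 3
      then have "u = ?\<theta> v" using cross e uv vu by auto
      then have "e = {v, ?\<theta> v}" using uv by auto
      then show ?thesis using e 3 by (simp add: B_def)
    next
      case 4
      have "?\<theta> ` e \<in> nn_edges" using reflect_image_nn_edges e by blast
      moreover have "?\<theta> ` e \<subseteq> H" using 4 HI e uv by auto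
      moreover have "e = ?\<theta> ` (?\<theta> ` e)" by (simp add: image_image)
      ultimately show ?thesis by (auto simp: free_edges_def)
    qed
  next
    fix e assume "e \<in> free_edges H \<union> (`) ?\<theta> ` free_edges H \<union> (\<lambda>u. {u, ?\<theta> u}) ` B"
    then show "e \<in> free_edges V"
      using HV \<theta>V by (auto simp: free_edges_def B_def intro: reflect_image_nn_edges)
  qed
  have bij: "bij_betw ?\<theta> V V"
    by (rule bij_betw_byWitness[where f' = ?\<theta>]) (use \<theta>V in auto)
  have imgE: "(`) ?\<theta> ` free_edges V = free_edges V"
  proof -
    have *: "?\<theta> ` e \<in> free_edges V" if "e \<in> free_edges V" for e
      using that \<theta>V reflect_image_nn_edges by (auto simp: free_edges_def)
    then have "e \<in> (`) ?\<theta> ` free_edges V" if "e \<in> free_edges V" for e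
      using that by (intro image_eqI[of _ _ "?\<theta> ` e"]) (simp_all add: image_image)
    with * show ?thesis by blast
  qed
  note transport = corr_transport[OF edges_in_free_edges[OF V] bij imgE]
  have fH: "finite H" using V HV finite_subset by blast
  have "corr V (free_edges V) \<beta> x y + corr V (free_edges V) \<beta> (?\<theta> x) (?\<theta> y)
      - corr V (free_edges V) \<beta> x (?\<theta> y) - corr V (free_edges V) \<beta> (?\<theta> x) y
      \<le> 2 * corr H (free_edges H) \<beta> x y"
    by (rule reflection_inequality[OF fH edges_in_free_edges[OF fH] _ \<beta> inj disj xy V_eq edges])
       (auto simp: B_def)
  moreover have "corr V (free_edges V) \<beta> (?\<theta> x) (?\<theta> y) = corr V (free_edges V) \<beta> x y"
    using transport xy HV by blast
  moreover have "corr V (free_edges V) \<beta> (?\<theta> x) y = corr V (free_edges V) \<beta> x (?\<theta> y)"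
    using transport[of x "?\<theta> y" \<beta>] xy HV \<theta>V by auto
  ultimately show ?thesis unfolding free_corr_eq_corr by linarith
qed
section \<open>Unfolding a box across its faces\<close>

text \<open>
  Reflecting in single faces produces boxes that are not centred at the origin.
\<close>

definition int_box :: "('d \<Rightarrow> int) \<Rightarrow> ('d \<Rightarrow> int) \<Rightarrow> (int ^ 'd) set" where
  "int_box a b = {x. \<forall>i. a i \<le> x $ i \<and> x $ i \<le> b i}"

lemma finite_int_box: "finite (int_box a b :: (int ^ 'd) set)"
proof (rule finite_subset)
  show "(int_box a b :: (int ^ 'd) set) \<subseteq> vec_lambda ` (\<Pi>\<^sub>E i\<in>UNIV. {a i..b i})"
  proof
    fix x :: "int ^ 'd" assume "x \<in> int_box a b"
    then have "vec_nth x \<in> (\<Pi>\<^sub>E i\<in>UNIV. {a i..b i})" by (auto simp: int_box_def)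
    then show "x \<in> vec_lambda ` (\<Pi>\<^sub>E i\<in>UNIV. {a i..b i})"
      by (metis image_eqI vec_nth_inverse)
  qed
  show "finite (vec_lambda ` (\<Pi>\<^sub>E i\<in>UNIV. {a i..b i}) :: (int ^ 'd) set)"
    by (intro finite_imageI finite_PiE) auto
qed

lemma box_lattice_eq_int_box: "box_lattice (real k) = int_box (\<lambda>_. - int k) (\<lambda>_. int k)"
proof -
  have "- real k \<le> real_of_int z \<longleftrightarrow> - int k \<le> z" "real_of_int z \<le> real k \<longleftrightarrow> z \<le> int k" for z
    by linarith+
  then show ?thesis unfolding box_lattice_def int_box_def by simp
qed

text \<open>
  The box with upper face \<open>2 b\<^sub>i + 1 - a\<^sub>i\<close> consists of the given box and its reflection in the face \<open>b\<^sub>i\<close>.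
\<close>

lemma free_corr_unfold_upper_face:
  fixes x y :: "int ^ 'd" and i :: 'd
  assumes \<beta>: "0 \<le> \<beta>" and xy: "x \<in> int_box a b" "y \<in> int_box a b"
  defines "b' \<equiv> b(i := 2 * b i + 1 - a i)"
  shows "reflect i (b i) y \<in> int_box a b'"
    and "free_corr (int_box a b') \<beta> x y - free_corr (int_box a b') \<beta> x (reflect i (b i) y)
      \<le> free_corr (int_box a b) \<beta> x y"
proof -
  have ab: "a i \<le> b i" using xy(1) unfolding int_box_def by (blast intro: order.trans)
  have sym: "reflect i (b i) u \<in> int_box a b'" if "u \<in> int_box a b'" for u
    unfolding int_box_def mem_Collect_eq
  proof
    fix j show "a j \<le> reflect i (b i) u $ j \<and> reflect i (b i) u $ j \<le> b' j"
      using that by (cases "j = i") (auto simp: int_box_def b'_def dest: spec[of _ j])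
  qed
  have H: "int_box a b = {u \<in> int_box a b'. u $ i \<le> b i}"
    unfolding int_box_def b'_def
  proof (intro Collect_cong iffI conjI CollectI allI)
    fix u :: "int ^ 'd" and j
    assume u: "\<forall>j. a j \<le> u $ j \<and> u $ j \<le> b j"
    show "a j \<le> u $ j" "u $ i \<le> b i" using u by blast+
    show "u $ j \<le> (b(i := 2 * b i + 1 - a i)) j" using u[rule_format, of j] ab by auto
  next
    fix u :: "int ^ 'd" and j
    assume u: "u \<in> {x. \<forall>j. a j \<le> x $ j \<and> x $ j \<le> (b(i := 2 * b i + 1 - a i)) j} \<and> u $ i \<le> b i"
    then have uj: "a j \<le> u $ j \<and> u $ j \<le> (b(i := 2 * b i + 1 - a i)) j" and ui: "u $ i \<le> b i" by blast+
    show "a j \<le> u $ j" "u $ j \<le> b j" using uj ui by (cases "j = i"; simp)+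
  qed
  have "y \<in> int_box a b'" using H xy by blast
  then show "reflect i (b i) y \<in> int_box a b'" by (rule sym)
  show "free_corr (int_box a b') \<beta> x y - free_corr (int_box a b') \<beta> x (reflect i (b i) y)
      \<le> free_corr (int_box a b) \<beta> x y"
    by (rule free_corr_reflection[OF finite_int_box _ \<beta> disjI1[OF H] xy]) (use sym in blast)
qed

lemma free_corr_unfold_lower_face:
  fixes x y :: "int ^ 'd" and i :: 'd
  assumes \<beta>: "0 \<le> \<beta>" and xy: "x \<in> int_box a b" "y \<in> int_box a b"
  defines "a' \<equiv> a(i := 2 * a i - 1 - b i)"
  shows "reflect i (a i - 1) y \<in> int_box a' b"
    and "free_corr (int_box a' b) \<beta> x y - free_corr (int_box a' b) \<beta> x (reflect i (a i - 1) y)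
      \<le> free_corr (int_box a b) \<beta> x y"
proof -
  have ab: "a i \<le> b i" using xy(1) unfolding int_box_def by (blast intro: order.trans)
  have sym: "reflect i (a i - 1) u \<in> int_box a' b" if "u \<in> int_box a' b" for u
    unfolding int_box_def mem_Collect_eq
  proof
    fix j show "a' j \<le> reflect i (a i - 1) u $ j \<and> reflect i (a i - 1) u $ j \<le> b j"
      using that by (cases "j = i") (auto simp: int_box_def a'_def dest: spec[of _ j])
  qed
  have H: "int_box a b = {u \<in> int_box a' b. a i - 1 < u $ i}"
    unfolding int_box_def a'_def
  proof (intro Collect_cong iffI conjI CollectI allI)
    fix u :: "int ^ 'd" and j
    assume u: "\<forall>j. a j \<le> u $ j \<and> u $ j \<le> b j"
    show "u $ j \<le> b j" using u by blast
    show "a i - 1 < u $ i" using u[rule_format, of i] by simp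
    show "(a(i := 2 * a i - 1 - b i)) j \<le> u $ j" using u[rule_format, of j] ab by auto
  next
    fix u :: "int ^ 'd" and j
    assume u: "u \<in> {x. \<forall>j. (a(i := 2 * a i - 1 - b i)) j \<le> x $ j \<and> x $ j \<le> b j} \<and> a i - 1 < u $ i"
    then have uj: "(a(i := 2 * a i - 1 - b i)) j \<le> u $ j \<and> u $ j \<le> b j" and ui: "a i - 1 < u $ i" by blast+
    show "a j \<le> u $ j" "u $ j \<le> b j" using uj ui by (cases "j = i"; simp)+
  qed
  have "y \<in> int_box a' b" using H xy by blast
  then show "reflect i (a i - 1) y \<in> int_box a' b" by (rule sym)
  show "free_corr (int_box a' b) \<beta> x y - free_corr (int_box a' b) \<beta> x (reflect i (a i - 1) y)
      \<le> free_corr (int_box a b) \<beta> x y"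
    by (rule free_corr_reflection[OF finite_int_box _ \<beta> disjI2[OF H] xy]) (use sym in blast)
qed

lemma int_box_mono:
  assumes "\<And>i. a' i \<le> a i" "\<And>i. b i \<le> b' i"
  shows "int_box a b \<subseteq> int_box a' b'"
  unfolding int_box_def using assms by (blast intro: order.trans)

lemma component_le_dist_euclid:
  "\<bar>real_of_int (x $ i) - real_of_int (y $ i)\<bar> \<le> dist (euclid x) (euclid y)"
  using component_le_norm_cart[of "euclid x - euclid y" i] by (simp add: dist_norm euclid_def)

context
  fixes \<beta> C :: real and p n :: nat and x y :: "int ^ 'd"
  assumes \<beta>: "0 \<le> \<beta>" and C: "0 \<le> C"
    and decay: "\<And>\<Lambda> u v :: int ^ 'd. finite \<Lambda> \<Longrightarrow> u \<in> \<Lambda> \<Longrightarrow> v \<in> \<Lambda> \<Longrightarrow> u \<noteq> v \<Longrightarrow>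
          free_corr \<Lambda> \<beta> u v \<le> C / dist (euclid u) (euclid v) ^ p"
    and x: "\<And>i. \<bar>x $ i\<bar> \<le> int n" and y: "\<And>i. \<bar>y $ i\<bar> \<le> int n"
begin

lemma in_int_box:
  assumes "\<And>i. a i \<le> - int l" "\<And>i. int l \<le> b i" "n \<le> l"
  shows "x \<in> int_box a b" "y \<in> int_box a b"
proof -
  have "a i \<le> z \<and> z \<le> b i" if "\<bar>z\<bar> \<le> int n" for z i
    using assms(1)[of i] assms(2)[of i] assms(3) that by linarith
  then show "x \<in> int_box a b" "y \<in> int_box a b"
    unfolding int_box_def using x y by blast+
qed

text \<open>
  The cost of one reflection: \<open>z\<close> will be an image of \<open>y\<close> beyond a face of a box of inner radius \<open>l\<close>.
\<close>

lemma image_term_le: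
  assumes \<Lambda>: "finite \<Lambda>" "x \<in> \<Lambda>" "z \<in> \<Lambda>" and l: "n < l" and far: "int l - int n \<le> \<bar>x $ i - z $ i\<bar>"
  shows "free_corr \<Lambda> \<beta> x z \<le> C / (real l - real n) ^ p"
proof -
  have "x \<noteq> z" using far l by auto
  have "real l - real n \<le> real_of_int \<bar>x $ i - z $ i\<bar>"
    using far by linarith
  also have "\<dots> \<le> dist (euclid x) (euclid z)"
    using component_le_dist_euclid[of x i z] by simp
  finally have "real l - real n \<le> dist (euclid x) (euclid z)" .
  then have "C / dist (euclid x) (euclid z) ^ p \<le> C / (real l - real n) ^ p"
    using l C by (intro divide_left_mono power_mono mult_pos_pos zero_less_power) auto
  then show ?thesis using decay[OF \<Lambda> \<open>x \<noteq> z\<close>] by linarith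
qed

text \<open>
  Reflecting in the upper face and then in the lower one enlarges the interval on both sides, and
  each image of \<open>y\<close> lies beyond a face, hence at distance at least \<open>l - n\<close> from \<open>x\<close>.
\<close>

lemma unfold_coordinate:
  assumes a: "\<And>j. a j \<le> - int l" and b: "\<And>j. int l \<le> b j" and l: "n < l"
  obtains a' b' where "\<And>j. a' j \<le> a j" "\<And>j. b j \<le> b' j" "a' i \<le> - int (2 * l)" "int (2 * l) \<le> b' i"
    "free_corr (int_box a' b') \<beta> x y - 2 * (C / (real l - real n) ^ p) \<le> free_corr (int_box a b) \<beta> x y"
proof -
  define b' where "b' = b(i := 2 * b i + 1 - a i)"
  define a' where "a' = a(i := 2 * a i - 1 - b' i)"
  have b': "int l \<le> b' j" "b j \<le> b' j" for j
    using a[of j] b[of j] by (auto simp: b'_def)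
  have a': "a' j \<le> a j" for j
    using a[of j] b'(1)[of j] by (auto simp: a'_def)
  have big: "a' i \<le> - int (2 * l)" "int (2 * l) \<le> b' i"
    using a[of i] b[of i] by (auto simp: a'_def b'_def)
  have xy: "x \<in> int_box a b" "y \<in> int_box a b"
    by (rule in_int_box[OF a b less_imp_le[OF l]])+
  have xy': "x \<in> int_box a b'" "y \<in> int_box a b'"
    by (rule in_int_box[OF a b'(1) less_imp_le[OF l]])+
  have xy'': "x \<in> int_box a' b'" using int_box_mono[of a' a b' b', OF a'] xy' by auto
  let ?\<delta> = "C / (real l - real n) ^ p"
  have "free_corr (int_box a b') \<beta> x (reflect i (b i) y) \<le> ?\<delta>"
  proof (rule image_term_le[OF finite_int_box xy'(1) _ l, where i = i])
    show "reflect i (b i) y \<in> int_box a b'"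
      unfolding b'_def by (rule free_corr_unfold_upper_face(1)[OF \<beta> xy])
    show "int l - int n \<le> \<bar>x $ i - reflect i (b i) y $ i\<bar>"
      using x[of i] y[of i] b[of i] l by simp
  qed
  then have 1: "free_corr (int_box a b') \<beta> x y - ?\<delta> \<le> free_corr (int_box a b) \<beta> x y"
    using free_corr_unfold_upper_face(2)[OF \<beta> xy, where i = i] unfolding b'_def by linarith
  have "free_corr (int_box a' b') \<beta> x (reflect i (a i - 1) y) \<le> ?\<delta>"
  proof (rule image_term_le[OF finite_int_box xy'' _ l, where i = i])
    show "reflect i (a i - 1) y \<in> int_box a' b'"
      unfolding a'_def by (rule free_corr_unfold_lower_face(1)[OF \<beta> xy'])
    show "int l - int n \<le> \<bar>x $ i - reflect i (a i - 1) y $ i\<bar>"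
      using x[of i] y[of i] a[of i] l by simp
  qed
  then have 2: "free_corr (int_box a' b') \<beta> x y - ?\<delta> \<le> free_corr (int_box a b') \<beta> x y"
    using free_corr_unfold_lower_face(2)[OF \<beta> xy', where i = i] unfolding a'_def by linarith
  show ?thesis by (rule that[OF a' b'(2) big]) (use 1 2 in linarith)
qed

lemma double_box:
  assumes a: "\<And>j. a j \<le> - int l" and b: "\<And>j. int l \<le> b j" and l: "n < l"
  obtains a' b' where "\<And>j. a' j \<le> - int (2 * l)" "\<And>j. int (2 * l) \<le> b' j"
    "free_corr (int_box a' b') \<beta> x y - 2 * real CARD('d) * (C / (real l - real n) ^ p)
       \<le> free_corr (int_box a b) \<beta> x y"
proof -
  let ?\<delta> = "C / (real l - real n) ^ p"
  have "\<exists>a' b'. (\<forall>j. a' j \<le> a j \<and> b j \<le> b' j) \<and> (\<forall>j\<in>I. a' j \<le> - int (2 * l) \<and> int (2 * l) \<le> b' j)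
      \<and> free_corr (int_box a' b') \<beta> x y - 2 * real (card I) * ?\<delta> \<le> free_corr (int_box a b) \<beta> x y"
    if "finite I" for I :: "'d set"
    using that
  proof induction
    case empty
    show ?case by (intro exI[of _ a] exI[of _ b]) simp
  next
    case (insert i I)
    then obtain a' b' where ab': "\<And>j. a' j \<le> a j" "\<And>j. b j \<le> b' j"
      "\<And>j. j \<in> I \<Longrightarrow> a' j \<le> - int (2 * l) \<and> int (2 * l) \<le> b' j"
      and le: "free_corr (int_box a' b') \<beta> x y - 2 * real (card I) * ?\<delta> \<le> free_corr (int_box a b) \<beta> x y"
      by blast
    have ab'l: "a' j \<le> - int l" "int l \<le> b' j" for j
      using ab'(1)[of j] ab'(2)[of j] a[of j] b[of j] by linarith+
    obtain a'' b'' where ab'':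
      "\<And>j. a'' j \<le> a' j" "\<And>j. b' j \<le> b'' j" "a'' i \<le> - int (2 * l)" "int (2 * l) \<le> b'' i"
      "free_corr (int_box a'' b'') \<beta> x y - 2 * ?\<delta> \<le> free_corr (int_box a' b') \<beta> x y"
      by (rule unfold_coordinate[of a' l b' i, OF ab'l l]) (rule that)
    have "free_corr (int_box a'' b'') \<beta> x y - 2 * real (card (insert i I)) * ?\<delta>
        \<le> free_corr (int_box a b) \<beta> x y"
      using ab''(5) le insert.hyps by (simp add: algebra_simps)
    moreover have "a'' j \<le> a j \<and> b j \<le> b'' j" for j
      using ab'(1,2)[of j] ab''(1,2)[of j] by linarith
    moreover have "a'' j \<le> - int (2 * l) \<and> int (2 * l) \<le> b'' j" if "j \<in> insert i I" for j
      using that ab''(1,2)[of j] ab'(3)[of j] ab''(3,4) by force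
    ultimately show ?case by blast
  qed
  from this[of UNIV] that show ?thesis by auto
qed

text \<open>
  At radius \<open>2\<^sup>k l\<close> the cost has decreased by a factor \<open>2\<^bsup>-kp\<^esup> \<le> 2\<^bsup>-k\<^esup>\<close>, since
  \<open>2\<^sup>k l - n \<ge> 2\<^sup>k (l - n)\<close>.
\<close>

lemma unfold_box:
  assumes l: "n < l" and p: "0 < p"
  obtains a b where "\<And>j. a j \<le> - int (2 ^ k * l)" "\<And>j. int (2 ^ k * l) \<le> b j"
    "free_corr (int_box a b) \<beta> x y - 2 * real CARD('d) * (C / (real l - real n) ^ p) * (\<Sum>j<k. (1 / 2) ^ j)
       \<le> free_corr (box_lattice (real l)) \<beta> x y"
proof -
  let ?K = "2 * real CARD('d)" and ?\<delta> = "C / (real l - real n) ^ p"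
  have "\<exists>a b. (\<forall>j. a j \<le> - int (2 ^ k * l) \<and> int (2 ^ k * l) \<le> b j) \<and>
    free_corr (int_box a b) \<beta> x y - ?K * ?\<delta> * (\<Sum>j<k. (1 / 2) ^ j) \<le> free_corr (box_lattice (real l)) \<beta> x y"
  proof (induction k)
    case 0
    show ?case
      by (intro exI[of _ "\<lambda>_. - int l"] exI[of _ "\<lambda>_. int l"]) (simp add: box_lattice_eq_int_box)
  next
    case (Suc k)
    then obtain a b where ab: "\<And>j. a j \<le> - int (2 ^ k * l)" "\<And>j. int (2 ^ k * l) \<le> b j"
      and le: "free_corr (int_box a b) \<beta> x y - ?K * ?\<delta> * (\<Sum>j<k. (1 / 2) ^ j)
         \<le> free_corr (box_lattice (real l)) \<beta> x y" by blast
    have "1 * l \<le> 2 ^ k * l" by (rule mult_right_mono) simp_all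
    then have "n < 2 ^ k * l" using l by linarith
    obtain a' b' where
      ab': "\<And>j. a' j \<le> - int (2 * (2 ^ k * l))" "\<And>j. int (2 * (2 ^ k * l)) \<le> b' j"
      and le': "free_corr (int_box a' b') \<beta> x y - ?K * (C / (real (2 ^ k * l) - real n) ^ p)
        \<le> free_corr (int_box a b) \<beta> x y"
      by (rule double_box[OF ab \<open>n < 2 ^ k * l\<close>]) (rule that)
    have "C / (real (2 ^ k * l) - real n) ^ p \<le> ?\<delta> * (1 / 2) ^ k"
    proof -
      have n: "real n \<le> 2 ^ k * real n"
        by (rule mult_right_le_imp_le[of _ 1]) (simp_all add: mult_le_cancel_right1)
      have "real n < real (2 ^ k * l)" using \<open>n < 2 ^ k * l\<close> by (simp only: of_nat_less_iff)
      then have nl: "real n < 2 ^ k * real l" by simp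
      have "(2 ^ k) ^ 1 \<le> ((2::real) ^ k) ^ p"
        using p by (intro power_increasing) auto
      then have "2 ^ k * (real l - real n) ^ p \<le> (2 ^ k) ^ p * (real l - real n) ^ p"
        using l by (intro mult_right_mono) auto
      also have "\<dots> = (2 ^ k * (real l - real n)) ^ p" by (simp add: power_mult_distrib)
      also have "\<dots> \<le> (real (2 ^ k * l) - real n) ^ p"
        using l n by (intro power_mono) (auto simp: right_diff_distrib)
      finally have "C / (real (2 ^ k * l) - real n) ^ p \<le> C / (2 ^ k * (real l - real n) ^ p)"
        using l C nl
        by (intro divide_left_mono mult_pos_pos zero_less_power) auto
      then show ?thesis by (simp add: field_simps)
    qed
    then have "?K * (C / (real (2 ^ k * l) - real n) ^ p) \<le> ?K * (?\<delta> * (1 / 2) ^ k)"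
      by (intro mult_left_mono) auto
    then have "free_corr (int_box a' b') \<beta> x y - ?K * ?\<delta> * (\<Sum>j<Suc k. (1 / 2) ^ j)
         \<le> free_corr (box_lattice (real l)) \<beta> x y"
      using le le' by (simp add: distrib_left)
    then show ?case using ab' by (intro exI[of _ a'] exI[of _ b']) (simp add: mult.assoc)
  qed
  then show ?thesis using that by blast
qed

text \<open>
  The unfolded boxes exhaust the lattice, while the total cost of unfolding stays bounded by a
  geometric series.
\<close>

lemma free_corr_le_box:
  assumes l: "n < l" and p: "0 < p" and \<Lambda>: "finite \<Lambda>" "x \<in> \<Lambda>" "y \<in> \<Lambda>"
  shows "free_corr \<Lambda> \<beta> x y - 4 * real CARD('d) * (C / (real l - real n) ^ p)
    \<le> free_corr (box_lattice (real l)) \<beta> x y"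
proof -
  let ?K = "2 * real CARD('d)" and ?\<delta> = "C / (real l - real n) ^ p"
  \<comment> \<open>A crude bound on all coordinates of all sites in \<open>\<Lambda>\<close>.\<close>
  define N where "N = (\<Sum>u\<in>\<Lambda>. \<Sum>i\<in>UNIV. \<bar>u $ i\<bar>)"
  have N: "\<bar>u $ i\<bar> \<le> N" if "u \<in> \<Lambda>" for u i
  proof -
    have "\<bar>u $ i\<bar> \<le> (\<Sum>i\<in>UNIV. \<bar>u $ i\<bar>)" by (rule member_le_sum) auto
    also have "\<dots> \<le> N" unfolding N_def by (rule member_le_sum[OF that]) (auto simp: sum_nonneg \<Lambda>)
    finally show ?thesis .
  qed
  define k where "k = nat N"
  obtain a b where ab: "\<And>j. a j \<le> - int (2 ^ k * l)" "\<And>j. int (2 ^ k * l) \<le> b j"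
    and le: "free_corr (int_box a b) \<beta> x y - ?K * ?\<delta> * (\<Sum>j<k. (1 / 2) ^ j)
       \<le> free_corr (box_lattice (real l)) \<beta> x y"
    using unfold_box[OF l p] by blast
  have "k * 1 \<le> 2 ^ k * l" using l by (intro mult_mono less_imp_le[OF less_exp]) auto
  then have kl: "N \<le> int (2 ^ k * l)" unfolding k_def by linarith
  have "\<Lambda> \<subseteq> int_box a b"
    unfolding int_box_def
  proof (intro subsetI CollectI allI)
    fix u i assume "u \<in> \<Lambda>"
    then show "a i \<le> u $ i \<and> u $ i \<le> b i"
      using N[of u i] ab(1)[of i] ab(2)[of i] kl by linarith
  qed
  then have mono: "free_corr \<Lambda> \<beta> x y \<le> free_corr (int_box a b) \<beta> x y"
    by (intro free_corr_mono finite_int_box \<beta> \<Lambda>)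
  have "(\<Sum>j<k. (1 / 2 :: real) ^ j) = 2 - 2 * (1 / 2) ^ k"
    by (induction k) auto
  then have "(\<Sum>j<k. (1 / 2 :: real) ^ j) \<le> 2" by simp
  moreover have "0 \<le> ?K * ?\<delta>" using C l by simp
  ultimately have "?K * ?\<delta> * (\<Sum>j<k. (1 / 2) ^ j) \<le> ?K * ?\<delta> * 2"
    by (intro mult_left_mono)
  then show ?thesis using mono le by linarith
qed

end

lemma dist_euclid_le:
  fixes x y :: "int ^ 'd"
  assumes "\<And>i. \<bar>x $ i\<bar> \<le> int n" "\<And>i. \<bar>y $ i\<bar> \<le> int n"
  shows "dist (euclid x) (euclid y) \<le> 2 * real CARD('d) * real n"
proof -
  have "dist (euclid x) (euclid y) \<le> (\<Sum>i\<in>UNIV. \<bar>(euclid x - euclid y) $ i\<bar>)"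
    unfolding dist_norm by (rule norm_le_l1_cart)
  also have "\<dots> \<le> (\<Sum>i\<in>(UNIV :: 'd set). 2 * real n)"
  proof (rule sum_mono)
    fix i
    have "\<bar>x $ i - y $ i\<bar> \<le> 2 * int n" using assms(1)[of i] assms(2)[of i] by linarith
    then have "real_of_int \<bar>x $ i - y $ i\<bar> \<le> 2 * real n" by linarith
    then show "\<bar>(euclid x - euclid y) $ i\<bar> \<le> 2 * real n" by (simp add: euclid_def)
  qed
  finally show ?thesis by (simp add: mult_ac)
qed

lemma ex_nn_edge: "\<exists>x y :: int ^ 'd. x \<noteq> y \<and> {x, y} \<in> nn_edges"
proof -
  have "{0, axis i 1} \<in> nn_edges" for i :: 'd
    unfolding doubleton_nn_edges_iff by (simp add: axis_def if_distrib[of abs] cong: if_cong)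
  moreover have "(0 :: int ^ 'd) \<noteq> axis i 1" for i by (simp add: vec_eq_iff axis_def)
  ultimately show ?thesis by blast
qed

theorem theorem1:
  fixes c C :: real
  assumes dim: "CARD('d::finite) \<ge> 4"
    and c_pos: "0 < c" and c_le_C: "c \<le> C"
    and two_point: "\<And>x y :: int ^ 'd. x \<noteq> y \<Longrightarrow>
        c * dist (euclid x) (euclid y) powi (- (int CARD('d) - 2)) \<le> critical_two_point x y \<and>
        critical_two_point x y \<le> C * dist (euclid x) (euclid y) powi (- (int CARD('d) - 2))"
  shows "\<exists>M c1 :: real. M > 1 \<and> c1 > 0 \<and>
    (\<forall>n :: nat. \<forall>x \<in> (box_lattice (real n) :: (int ^ 'd) set). \<forall>y \<in> box_lattice (real n). x \<noteq> y \<longrightarrow>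
        c1 * dist (euclid x) (euclid y) powi (- (int CARD('d) - 2))
          \<le> critical_free_two_point (box_lattice (M * real n)) x y \<and>
        critical_free_two_point (box_lattice (M * real n)) x y
          \<le> C * dist (euclid x) (euclid y) powi (- (int CARD('d) - 2)))"
proof -
  define p where "p = CARD('d) - 2"
  have p: "0 < p" using dim by (simp add: p_def)
  have powi: "r powi (- (int CARD('d) - 2)) = 1 / r ^ p" for r :: real
  proof -
    have "- (int CARD('d) - 2) = - int p" using dim by (simp add: p_def)
    then show ?thesis by (simp add: power_int_minus divide_inverse)
  qed
  let ?\<beta> = "beta_c TYPE('d)" and ?dist = "\<lambda>x y :: int ^ 'd. dist (euclid x) (euclid y)"
  have crit: "critical_free_two_point \<Lambda> x y = free_corr \<Lambda> ?\<beta> x y" for \<Lambda> and x y :: "int ^ 'd"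
    unfolding critical_free_two_point_def free_corr_def ..
  have lim: "critical_two_point x y = Lim (finite_subsets_at_top UNIV) (\<lambda>\<Lambda>. free_corr \<Lambda> ?\<beta> x y)"
    for x y :: "int ^ 'd"
    unfolding critical_two_point_def crit ..
  have C: "0 < C" using c_pos c_le_C by linarith
  have dist_pos: "0 < ?dist x y" if "x \<noteq> y" for x y
    using that by (simp add: euclid_def vec_eq_iff)
  \<comment> \<open>An infimum over an empty set of reals has no specified value, so the sign is derived from the positivity of the two-point function.\<close>
  have \<beta>: "0 \<le> ?\<beta>"
  proof (rule ccontr)
    assume neg: "\<not> 0 \<le> ?\<beta>"
    obtain x y :: "int ^ 'd" where xy: "x \<noteq> y" "{x, y} \<in> nn_edges"
      using ex_nn_edge by blast
    have "0 < c * (1 / ?dist x y ^ p)" using c_pos dist_pos[OF xy(1)] by simp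
    also have "\<dots> \<le> critical_two_point x y" using two_point[OF xy(1)] unfolding powi by blast
    also have "\<dots> \<le> 0"
      unfolding lim by (rule Lim_free_corr_neighbours_nonpos[OF _ xy(2)]) (use neg in simp)
    finally show False by simp
  qed
  have decay: "free_corr \<Lambda> ?\<beta> x y \<le> C / ?dist x y ^ p"
    if "finite \<Lambda>" "x \<in> \<Lambda>" "y \<in> \<Lambda>" "x \<noteq> y" for \<Lambda> x y
  proof -
    obtain L where "((\<lambda>\<Lambda>. free_corr \<Lambda> ?\<beta> x y) \<longlongrightarrow> L) (finite_subsets_at_top UNIV)"
      and "\<And>\<Lambda>. finite \<Lambda> \<Longrightarrow> x \<in> \<Lambda> \<Longrightarrow> y \<in> \<Lambda> \<Longrightarrow> free_corr \<Lambda> ?\<beta> x y \<le> L"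
      by (rule free_corr_limit[OF \<beta>]) blast
    then have "free_corr \<Lambda> ?\<beta> x y \<le> critical_two_point x y"
      unfolding lim using that by (subst tendsto_Lim) auto
    then show ?thesis using two_point[OF that(4)] unfolding powi by simp
  qed
  have large_volume: "\<exists>\<Lambda>. finite \<Lambda> \<and> x \<in> \<Lambda> \<and> y \<in> \<Lambda> \<and> r < free_corr \<Lambda> ?\<beta> x y"
    if "r < critical_two_point x y" for r and x y :: "int ^ 'd"
  proof -
    obtain L where lim_L: "((\<lambda>\<Lambda>. free_corr \<Lambda> ?\<beta> x y) \<longlongrightarrow> L) (finite_subsets_at_top UNIV)"
      and L: "\<And>r. r < L \<Longrightarrow> \<exists>\<Lambda>. finite \<Lambda> \<and> x \<in> \<Lambda> \<and> y \<in> \<Lambda> \<and> r < free_corr \<Lambda> ?\<beta> x y"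
      by (rule free_corr_limit[OF \<beta>]) blast
    have "critical_two_point x y = L" unfolding lim by (intro tendsto_Lim lim_L) simp
    then show ?thesis using L that by simp
  qed
  let ?d = "real CARD('d)"
  \<comment> \<open>Chosen so that \<open>4 d C / K \<le> c / 2\<close>, which makes the cost of unfolding at most half of the lower bound.\<close>
  define K where "K = nat \<lceil>8 * ?d * C / c\<rceil> + 1"
  have K: "8 * ?d * C / c \<le> real K" "1 \<le> K"
    unfolding K_def by linarith+
  \<comment> \<open>With this choice \<open>M n - n\<close> is \<open>K\<close> times the bound \<open>2 d n\<close> on the distances in the inner box.\<close>
  define M where "M = 1 + 2 * CARD('d) * K"
  have M: "real M > 1" using K by (simp add: M_def)
  have "c / 2 * (1 / ?dist x y ^ p) \<le> free_corr (box_lattice (real M * real n)) ?\<beta> x y \<and>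
      free_corr (box_lattice (real M * real n)) ?\<beta> x y \<le> C * (1 / ?dist x y ^ p)"
    if xy: "x \<in> box_lattice (real n)" "y \<in> box_lattice (real n)" "x \<noteq> y" for n :: nat and x y :: "int ^ 'd"
  proof
    have xn: "\<bar>x $ i\<bar> \<le> int n" and yn: "\<bar>y $ i\<bar> \<le> int n" for i
      using xy(1,2) unfolding box_lattice_eq_int_box int_box_def by (auto simp: abs_le_iff minus_le_iff)
    have n: "0 < n"
      using xn yn xy(3) by (cases "n = 0") (auto simp: vec_eq_iff)
    let ?D = "2 * ?d * real n"
    have D: "0 < ?D" using n by simp
    have l: "n < M * n" using n K by (simp add: M_def)
    have box: "real M * real n = real (M * n)" by simp
    have "n \<le> M * n" using l by simp
    then have mem: "x \<in> box_lattice (real (M * n))" "y \<in> box_lattice (real (M * n))"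
      using int_box_mono[of "\<lambda>_. - int (M * n)" "\<lambda>_. - int n" "\<lambda>_. int n" "\<lambda>_. int (M * n)"] xy(1,2)
      unfolding box_lattice_eq_int_box by (auto simp del: of_nat_mult)
    have fin: "finite (box_lattice (real (M * n)) :: (int ^ 'd) set)"
      unfolding box_lattice_eq_int_box by (rule finite_int_box)
    show "free_corr (box_lattice (real M * real n)) ?\<beta> x y \<le> C * (1 / ?dist x y ^ p)"
      using decay[OF fin mem xy(3)] unfolding box by simp
    have error: "4 * ?d * (C / (real (M * n) - real n) ^ p) \<le> c / 2 * (1 / ?dist x y ^ p)"
    proof -
      have "real (M * n) - real n = real K * ?D" by (simp add: M_def algebra_simps)
      then have "4 * ?d * (C / (real (M * n) - real n) ^ p) = 4 * ?d * C / real K ^ p / ?D ^ p"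
        by (simp add: power_mult_distrib)
      also have "\<dots> \<le> c / 2 / ?D ^ p"
      proof (rule divide_right_mono)
        have "4 * ?d * C \<le> c / 2 * real K" using K(1) c_pos by (simp add: field_simps)
        also have "\<dots> \<le> c / 2 * real K ^ p"
          using K(2) p c_pos by (intro mult_left_mono self_le_power) auto
        finally show "4 * ?d * C / real K ^ p \<le> c / 2" using K(2) by (simp add: divide_le_eq)
      qed (use D in simp)
      also have "\<dots> \<le> c / 2 / ?dist x y ^ p"
        using dist_euclid_le[of x n y, OF xn yn] dist_pos[OF xy(3)] c_pos D n
        by (intro divide_left_mono power_mono mult_pos_pos zero_less_power) auto
      finally show ?thesis by simp
    qed
    have "critical_two_point x y - c / 2 * (1 / ?dist x y ^ p)
        \<le> free_corr (box_lattice (real (M * n))) ?\<beta> x y"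
    proof (rule dense_le)
      fix r assume "r < critical_two_point x y - c / 2 * (1 / ?dist x y ^ p)"
      then have "r + c / 2 * (1 / ?dist x y ^ p) < critical_two_point x y" by linarith
      then obtain \<Lambda> where \<Lambda>: "finite \<Lambda>" "x \<in> \<Lambda>" "y \<in> \<Lambda>"
        and r: "r + c / 2 * (1 / ?dist x y ^ p) < free_corr \<Lambda> ?\<beta> x y"
        using large_volume by blast
      have "free_corr \<Lambda> ?\<beta> x y - 4 * ?d * (C / (real (M * n) - real n) ^ p)
          \<le> free_corr (box_lattice (real (M * n))) ?\<beta> x y"
        by (rule free_corr_le_box[OF \<beta> _ decay xn yn l p \<Lambda>]) (use C in auto)
      then show "r \<le> free_corr (box_lattice (real (M * n))) ?\<beta> x y" using r error by linarith
    qed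
    then show "c / 2 * (1 / ?dist x y ^ p) \<le> free_corr (box_lattice (real M * real n)) ?\<beta> x y"
      using two_point[OF xy(3)] unfolding powi box by simp
  qed
  then show ?thesis
    unfolding powi crit using M c_pos by (intro exI[of _ "real M"] exI[of _ "c / 2"]) auto
qed

end
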